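(* Fix any linear ordering of $[n]$. Every row of the forest compatibility matrix $F_n$ is a real linear combination of the rows of $F_n$ indexed by partitions of $[n]$ that are non-crossing with respect to this ordering; that is, the rows corresponding to non-crossing partitions span the row space of $F_n$.
   Context: $[n]=\{1,\dots,n\}$. A forest $G$ on vertex set $[n]\cup V$ (boundary $[n]$) is a representative forest of a partition $\pi$ of $[n]$ if for every block $S\in\pi$ there is a component $C$ of $G$ with $C\cap[n]=S$. Gluing two such graphs means taking their disjoint union and identifying the two copies of each boundary vertex. Partitions $\pi,\rho$ of $[n]$ induce a cycle if the glue of representative forests of $\pi$ and $\rho$ contains a cycle (independent of the representatives). $F_n$ has rows and columns indexed by partitions of $[n]$, $F_n[\pi,\rho]=0$ if $\pi,\rho$ induce a cycle and $1$ otherwise. Two blocks $A,B$ of a partition are crossing with respect to an ordering $<$ if there are $a_1,a_2\in A$, $b_1,b_2\in B$ with $a_1<b_1<a_2<b_2$ or $b_1<a_1<b_2<a_2$; a partition is non-crossing if no two of its blocks cross. *)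

theory Defs
  imports Complex_Main "HOL-Library.Disjoint_Sets" "HOL-Library.Function_Algebras"
begin

text \<open>
  Undirected multigraphs; a loop is an edge whose set of ends is a singleton. Parallel edges
  have to be kept: if both graphs being glued have an edge between boundary vertices
  \<open>i\<close> and \<open>j\<close>, then these are two edges of the glue and form a cycle of length 2.
\<close>

record ('v, 'e) mgraph =
  verts :: "'v set"
  edges :: "'e set"
  ends :: "'e \<Rightarrow> 'v set"

definition finite_mgraph :: "('v, 'e) mgraph \<Rightarrow> bool" where
  "finite_mgraph G \<longleftrightarrow> finite (verts G) \<and> finite (edges G) \<and>
     (\<forall>e\<in>edges G. ends G e \<subseteq> verts G \<and> card (ends G e) \<in> {1, 2})"

text \<open>
  The edge \<open>es ! i\<close> joins \<open>vs ! i\<close> to its cyclic successor. Length 1 is a loop, length 2 a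
  pair of parallel edges.
\<close>

definition is_cycle :: "('v, 'e) mgraph \<Rightarrow> 'v list \<Rightarrow> 'e list \<Rightarrow> bool" where
  "is_cycle G vs es \<longleftrightarrow>
     es \<noteq> [] \<and> length vs = length es \<and> distinct vs \<and> distinct es \<and>
     set vs \<subseteq> verts G \<and> set es \<subseteq> edges G \<and>
     (\<forall>i<length es. ends G (es ! i) = {vs ! i, vs ! (Suc i mod length es)})"

definition has_cycle :: "('v, 'e) mgraph \<Rightarrow> bool" where
  "has_cycle G \<longleftrightarrow> (\<exists>vs es. is_cycle G vs es)"

definition forest :: "('v, 'e) mgraph \<Rightarrow> bool" where
  "forest G \<longleftrightarrow> finite_mgraph G \<and> \<not> has_cycle G"

definition adj :: "('v, 'e) mgraph \<Rightarrow> 'v \<Rightarrow> 'v \<Rightarrow> bool" where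
  "adj G u v \<longleftrightarrow> (\<exists>e\<in>edges G. ends G e = {u, v})"

definition components :: "('v, 'e) mgraph \<Rightarrow> 'v set set" where
  "components G = {{w \<in> verts G. (adj G)\<^sup>*\<^sup>* v w} |v. v \<in> verts G}"

text \<open>
  In a graph with boundary, \<open>Inl i\<close> is the boundary vertex \<open>i\<close> and the vertices \<open>Inr v\<close> are
  the other ones.
\<close>

definition representative_forest ::
    "nat \<Rightarrow> nat set set \<Rightarrow> (nat + 'a, 'e) mgraph \<Rightarrow> bool" where
  "representative_forest n \<pi> G \<longleftrightarrow>
     forest G \<and> (\<exists>V. verts G = Inl ` {1..n} \<union> Inr ` V) \<and>
     (\<forall>S\<in>\<pi>. \<exists>C\<in>components G. C \<inter> Inl ` {1..n} = Inl ` S)"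

definition glue ::
    "('b + 'u, 'e) mgraph \<Rightarrow> ('b + 'v, 'f) mgraph \<Rightarrow> ('b + ('u + 'v), 'e + 'f) mgraph" where
  "glue G H =
     \<lparr>verts = map_sum id Inl ` verts G \<union> map_sum id Inr ` verts H,
      edges = edges G <+> edges H,
      ends = case_sum (\<lambda>e. map_sum id Inl ` ends G e) (\<lambda>f. map_sum id Inr ` ends H f)\<rparr>"

text \<open>
  Whether the glue has a cycle does not depend on the representatives. As they are finite,
  natural numbers suffice as names of non-boundary vertices and of edges.
\<close>

definition induce_cycle :: "nat \<Rightarrow> nat set set \<Rightarrow> nat set set \<Rightarrow> bool" where
  "induce_cycle n \<pi> \<rho> \<longleftrightarrow>
     (\<exists>(G :: (nat + nat, nat) mgraph) (H :: (nat + nat, nat) mgraph).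
        representative_forest n \<pi> G \<and> representative_forest n \<rho> H \<and> has_cycle (glue G H))"

definition partitions :: "nat \<Rightarrow> nat set set set" where
  "partitions n = {\<pi>. partition_on {1..n} \<pi>}"

definition forest_matrix :: "nat \<Rightarrow> nat set set \<Rightarrow> nat set set \<Rightarrow> real" where
  "forest_matrix n \<pi> \<rho> = (if induce_cycle n \<pi> \<rho> then 0 else 1)"

text \<open>
  The ordering is a reflexive relation \<open>r\<close> in the sense of \<^const>\<open>linear_order_on\<close>, so the
  strict ordering is \<open>r - Id\<close>.
\<close>

definition crossing :: "nat rel \<Rightarrow> nat set \<Rightarrow> nat set \<Rightarrow> bool" where
  "crossing r A B \<longleftrightarrow>
     (\<exists>a1\<in>A. \<exists>a2\<in>A. \<exists>b1\<in>B. \<exists>b2\<in>B.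
        (a1, b1) \<in> r - Id \<and> (b1, a2) \<in> r - Id \<and> (a2, b2) \<in> r - Id \<or>
        (b1, a1) \<in> r - Id \<and> (a1, b2) \<in> r - Id \<and> (b2, a2) \<in> r - Id)"

definition noncrossing :: "nat rel \<Rightarrow> nat set set \<Rightarrow> bool" where
  "noncrossing r \<pi> \<longleftrightarrow> (\<forall>A\<in>\<pi>. \<forall>B\<in>\<pi>. A \<noteq> B \<longrightarrow> \<not> crossing r A B)"

definition noncrossing_partitions :: "nat \<Rightarrow> nat rel \<Rightarrow> nat set set set" where
  "noncrossing_partitions n r = {\<pi> \<in> partitions n. noncrossing r \<pi>}"

text \<open>
  A row is a vector indexed by \<^term>\<open>partitions n\<close>, represented by a function that is zero
  elsewhere.
\<close>

definition forest_matrix_row :: "nat \<Rightarrow> nat set set \<Rightarrow> (nat set set \<Rightarrow> real)" where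
  "forest_matrix_row n \<pi> = (\<lambda>\<rho>. if \<rho> \<in> partitions n then forest_matrix n \<pi> \<rho> else 0)"

definition fun_scale :: "real \<Rightarrow> ('a \<Rightarrow> real) \<Rightarrow> ('a \<Rightarrow> real)" where
  "fun_scale c f = (\<lambda>x. c * f x)"

lemma vector_space_fun_scale: "vector_space fun_scale"
  by unfold_locales (auto simp: fun_scale_def fun_eq_iff algebra_simps)

definition fun_span :: "('a \<Rightarrow> real) set \<Rightarrow> ('a \<Rightarrow> real) set" where
  "fun_span = module.span fun_scale"

end

theory Submission
  imports Defs "HOL-Combinatorics.Permutations" "HOL-Library.Transitive_Closure_Table"
begin

text \<open>
  A finite multigraph is a forest iff its numbers of vertices, edges and components satisfy
  \<open>v = e + c\<close>. Applied to the glue of two representative forests, this shows that \<open>\<pi>\<close> and \<open>\<rho>\<close>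
  induce no cycle iff \<open>|\<pi>| + |\<rho>| = n + |\<pi> \<or> \<rho>|\<close>; merging two blocks of \<open>\<pi>\<close> keeps this equation
  iff the two blocks lie in different blocks of \<open>\<pi> \<or> \<rho>\<close>. Hence the rows obtained by merging four
  blocks \<open>A, B, C, D\<close> of a partition depend only on which of them are joined by \<open>\<rho>\<close>, and checking
  all equivalence relations on four points gives
  \<open>[AB|CD] + [AC|BD] + [AD|BC] + [ABCD] = [ABC|D] + [ABD|C] + [ACD|B] + [BCD|A]\<close>.

  Let \<open>\<pi>\<close> be non-crossing for an ordering and let \<open>i\<close>, \<open>j\<close> be adjacent in it, in different blocks
  \<open>P\<close> and \<open>Q\<close>. After exchanging \<open>i\<close> and \<open>j\<close> in the ordering, \<open>\<pi>\<close> may be crossing, but in the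
  relation for \<open>A = {i}\<close>, \<open>B = P - {i}\<close>, \<open>C = {j}\<close>, \<open>D = Q - {j}\<close> all other partitions are non-crossing.
  So the span of the non-crossing rows does not change under adjacent exchanges, hence it is the
  same for all orderings; and every partition is non-crossing for an ordering that lists its
  blocks one after the other.
\<close>

section \<open>Connectivity and the Euler formula\<close>

text \<open>The equivalence closure on the whole type. Being symmetric, it lets every edge be
  recorded as a pair in an arbitrary orientation.\<close>

definition conn :: "'a rel \<Rightarrow> 'a rel" where
  "conn E = (E \<union> E\<inverse>)\<^sup>*"

text \<open>\<open>V\<close> need not contain the field of \<open>E\<close>: connecting paths may leave \<open>V\<close>.\<close>

definition classes :: "'a set \<Rightarrow> 'a rel \<Rightarrow> 'a set set" where
  "classes V E = (\<lambda>v. V \<inter> conn E `` {v}) ` V"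

lemma conn_refl [simp]: "(x, x) \<in> conn E"
  by (simp add: conn_def)

lemma conn_sym: "(x, y) \<in> conn E \<Longrightarrow> (y, x) \<in> conn E"
  unfolding conn_def by (rule symD[OF sym_rtrancl]) (auto simp: sym_def)

lemma conn_sym_iff: "(x, y) \<in> conn E \<longleftrightarrow> (y, x) \<in> conn E"
  by (blast intro: conn_sym)

lemma conn_trans: "(x, y) \<in> conn E \<Longrightarrow> (y, z) \<in> conn E \<Longrightarrow> (x, z) \<in> conn E"
  unfolding conn_def by (rule rtrancl_trans)

lemma subset_conn: "E \<subseteq> conn E"
  by (auto simp: conn_def)

lemma conn_edge: "(x, y) \<in> E \<Longrightarrow> (x, y) \<in> conn E"
  using subset_conn by blast

lemma conn_minimal: "E \<subseteq> conn E' \<Longrightarrow> conn E \<subseteq> conn E'"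
proof -
  assume "E \<subseteq> conn E'"
  then have "E \<union> E\<inverse> \<subseteq> (E' \<union> E'\<inverse>)\<^sup>*"
    using conn_sym[of _ _ E'] unfolding conn_def by blast
  then show ?thesis
    unfolding conn_def by (rule rtrancl_subset_rtrancl)
qed

lemma conn_mono: "E \<subseteq> E' \<Longrightarrow> conn E \<subseteq> conn E'"
  using conn_minimal[of E E'] subset_conn[of E'] by blast

lemma conn_eqI: "E \<subseteq> conn E' \<Longrightarrow> E' \<subseteq> conn E \<Longrightarrow> conn E = conn E'"
  by (intro subset_antisym conn_minimal)

lemma conn_class_eq: "(x, y) \<in> conn E \<Longrightarrow> conn E `` {x} = conn E `` {y}"
  using conn_sym conn_trans by fast

lemma conn_induct [consumes 1, case_names base step]:
  assumes "(x, y) \<in> conn E" "P x"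
    and "\<And>y z. (x, y) \<in> conn E \<Longrightarrow> P y \<Longrightarrow> (y, z) \<in> E \<or> (z, y) \<in> E \<Longrightarrow> P z"
  shows "P y"
  using assms(1) unfolding conn_def
proof (induction rule: rtrancl_induct)
  case base
  then show ?case by (rule assms(2))
next
  case (step y z)
  then show ?case using assms(3)[of y z] by (auto simp: conn_def)
qed

text \<open>A walk can be shortened until it uses the new edge at most once. The three cases are:
  not at all, from \<open>u\<close> to \<open>v\<close>, or from \<open>v\<close> to
  \<open>u\<close>.\<close>

lemma conn_insert_iff:
  "(x, y) \<in> conn (insert (u, v) E) \<longleftrightarrow>
     (x, y) \<in> conn E \<or> (x, u) \<in> conn E \<and> (v, y) \<in> conn E \<or> (x, v) \<in> conn E \<and> (u, y) \<in> conn E"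
    (is "?L \<longleftrightarrow> ?R y")
proof
  assume ?L
  then show "?R y"
  proof (induction rule: conn_induct)
    case (step y z)
    then consider "y = u" "z = v" | "y = v" "z = u" | "(y, z) \<in> conn E"
      using subset_conn[of E] conn_sym[of _ _ E] by blast
    then show ?case
    proof cases
      case 3
      then show ?thesis using step.IH conn_trans[of _ y E z] by blast
    qed (use step.IH in auto)
  qed simp
next
  let ?E = "insert (u, v) E"
  assume R: "?R y"
  have "conn E \<subseteq> conn ?E" by (rule conn_mono) auto
  then consider "(x, y) \<in> conn ?E" | "(x, u) \<in> conn ?E" "(v, y) \<in> conn ?E"
    | "(x, v) \<in> conn ?E" "(u, y) \<in> conn ?E"
    using R by blast
  moreover have "(u, v) \<in> conn ?E" using subset_conn by blast
  ultimately show ?L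
    by cases (meson conn_trans conn_sym)+
qed

lemma finite_classes: "finite V \<Longrightarrow> finite (classes V E)"
  by (simp add: classes_def)

lemma conn_insert_same: "(u, v) \<in> conn E \<Longrightarrow> conn (insert (u, v) E) = conn E"
  by (rule conn_eqI) (use subset_conn in blast)+

lemma classes_cong: "conn E = conn E' \<Longrightarrow> classes V E = classes V E'"
  by (simp add: classes_def)

text \<open>The new edge fuses the two distinct classes of \<open>u\<close> and \<open>v\<close>
  into one and leaves all other classes unchanged.\<close>

lemma card_classes_insert:
  assumes "finite V" "u \<in> V" "v \<in> V" "(u, v) \<notin> conn E"
  shows "card (classes V E) = Suc (card (classes V (insert (u, v) E)))"
proof -
  let ?c = "\<lambda>x. V \<inter> conn E `` {x}"
  let ?d = "\<lambda>x. V \<inter> conn (insert (u, v) E) `` {x}"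
  let ?K = "classes V E"
  have c_eq: "?c x = ?c y \<longleftrightarrow> (x, y) \<in> conn E" if "x \<in> V" "y \<in> V" for x y
  proof
    assume "?c x = ?c y"
    moreover have "y \<in> ?c y" using that by simp
    ultimately show "(x, y) \<in> conn E" by blast
  qed (use conn_class_eq in metis)
  have d: "?d x = (if x \<in> ?c u \<union> ?c v then ?c u \<union> ?c v else ?c x)" if "x \<in> V" for x
  proof (cases "(x, u) \<in> conn E \<or> (x, v) \<in> conn E")
    case True
    then have "(x, y) \<in> conn (insert (u, v) E) \<longleftrightarrow> (u, y) \<in> conn E \<or> (v, y) \<in> conn E" for y
      unfolding conn_insert_iff using conn_trans[of _ _ E] conn_sym[of _ _ E] by metis
    then show ?thesis using True that conn_sym[of _ _ E] by auto
  next
    case False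
    then show ?thesis using that conn_sym[of _ _ E] by (auto simp: conn_insert_iff)
  qed
  have "classes V (insert (u, v) E) = insert (?c u \<union> ?c v) (?K - {?c u, ?c v})"
  proof
    show "classes V (insert (u, v) E) \<subseteq> insert (?c u \<union> ?c v) (?K - {?c u, ?c v})"
    proof
      fix C assume "C \<in> classes V (insert (u, v) E)"
      then obtain x where x: "x \<in> V" "C = ?d x" by (auto simp: classes_def)
      then show "C \<in> insert (?c u \<union> ?c v) (?K - {?c u, ?c v})"
        using d[OF x(1)] c_eq[OF x(1) assms(2)] c_eq[OF x(1) assms(3)] conn_sym
        by (auto simp: classes_def split: if_splits)
    qed
    show "insert (?c u \<union> ?c v) (?K - {?c u, ?c v}) \<subseteq> classes V (insert (u, v) E)"
    proof
      fix C assume C: "C \<in> insert (?c u \<union> ?c v) (?K - {?c u, ?c v})"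
      show "C \<in> classes V (insert (u, v) E)"
      proof (cases "C = ?c u \<union> ?c v")
        case True
        then have "C = ?d u" using d[OF assms(2)] assms(2) by auto
        then show ?thesis using assms(2) by (auto simp: classes_def)
      next
        case False
        then obtain x where x: "x \<in> V" "C = ?c x" "C \<noteq> ?c u" "C \<noteq> ?c v"
          using C by (auto simp: classes_def)
        then have "x \<notin> ?c u \<union> ?c v"
          using c_eq[OF assms(2) x(1)] c_eq[OF assms(3) x(1)] by auto
        then have "C = ?d x" using d[OF x(1)] x(2) by metis
        then show ?thesis using x(1) by (auto simp: classes_def)
      qed
    qed
  qed
  moreover have "?c u \<union> ?c v \<notin> ?K"
  proof
    assume "?c u \<union> ?c v \<in> ?K"
    then obtain x where "?c u \<union> ?c v = ?c x" by (auto simp: classes_def)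
    moreover have "u \<in> ?c u" "v \<in> ?c v" using assms by auto
    ultimately have "(x, u) \<in> conn E" "(x, v) \<in> conn E" by blast+
    then show False using assms(4) conn_sym conn_trans by metis
  qed
  \<comment> \<open>Two classes go and one comes. The lower bound keeps the subtraction on natural
    numbers from being truncated.\<close>
  moreover have "card (?K - {?c u, ?c v}) = card ?K - 2" "2 \<le> card ?K"
  proof -
    have sub: "{?c u, ?c v} \<subseteq> ?K" using assms by (auto simp: classes_def)
    have two: "card {?c u, ?c v} = 2" using c_eq[OF assms(2,3)] assms(4) by simp
    show "card (?K - {?c u, ?c v}) = card ?K - 2"
      using card_Diff_subset[OF _ sub] two by simp
    show "2 \<le> card ?K"
      using card_mono[OF finite_classes[OF assms(1)] sub] two by simp
  qed
  ultimately show ?thesis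
    using finite_classes[OF assms(1), of E] by (simp add: card_insert_if)
qed

text \<open>Injectivity lets a walk between image points be pulled back step by step. This moves
  each graph into the vertex type of the glue.\<close>

lemma classes_image:
  assumes "inj f"
  shows "classes (f ` V) (map_prod f f ` E) = (`) f ` classes V E"
proof -
  have "(f x, y) \<in> conn (map_prod f f ` E) \<longleftrightarrow> (\<exists>z. y = f z \<and> (x, z) \<in> conn E)" for x y
  proof
    assume "(f x, y) \<in> conn (map_prod f f ` E)"
    then show "\<exists>z. y = f z \<and> (x, z) \<in> conn E"
    proof (induction rule: conn_induct)
      case (step y z)
      then obtain w where w: "y = f w" "(x, w) \<in> conn E" by blast
      then obtain w' where "z = f w'" "(w, w') \<in> E \<or> (w', w) \<in> E"
        using step.hyps(2) injD[OF assms] by fastforce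
      then show ?case
        using w subset_conn[of E] by (blast intro: conn_trans conn_sym)
    qed auto
  next
    assume "\<exists>z. y = f z \<and> (x, z) \<in> conn E"
    then obtain z where y: "y = f z" and z: "(x, z) \<in> conn E" by blast
    from z have "(f x, f z) \<in> conn (map_prod f f ` E)"
    proof (induction rule: conn_induct)
      case (step y z)
      then have "(f y, f z) \<in> conn (map_prod f f ` E)"
        using subset_conn[of "map_prod f f ` E"] by (force intro: conn_sym)
      then show ?case using step.IH conn_trans by metis
    qed simp
    then show "(f x, y) \<in> conn (map_prod f f ` E)" using y by simp
  qed
  then have "f ` V \<inter> conn (map_prod f f ` E) `` {f x} = f ` (V \<inter> conn E `` {x})" for x
    using assms by (auto dest: injD)
  then show ?thesis by (simp add: classes_def image_image)
qed

text \<open>Without edges there are \<open>card V\<close> singleton classes, and each edge fuses at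
  most two. Edges are indexed by \<open>I\<close> because parallel edges may have the same pair of
  ends but must be counted separately.\<close>

lemma card_classes_ge:
  fixes f :: "'e \<Rightarrow> 'v \<times> 'v"
  assumes "finite V" "finite I" "f ` I \<subseteq> V \<times> V"
  shows "card V \<le> card I + card (classes V (f ` I))"
  using assms(2,3)
proof (induction I)
  case empty
  have "classes V (f ` {}) = (\<lambda>v. {v}) ` V" by (auto simp: classes_def conn_def)
  then show ?case by (simp add: card_image)
next
  case (insert e I)
  obtain u v where uv: "f e = (u, v)" by force
  show ?case
  proof (cases "f e \<in> conn (f ` I)")
    case True
    then have "classes V (f ` insert e I) = classes V (f ` I)"
      by (simp add: uv classes_def conn_insert_same)
    then show ?thesis using insert by simp
  next
    case False
    then show ?thesis
      using insert uv card_classes_insert[OF assms(1), of u v "f ` I"] by auto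
  qed
qed

text \<open>The right-hand side says that every edge is a bridge. An edge that closes a cycle makes
  the inequality of \<open>card_classes_ge\<close> strict; an edge that closes none keeps the
  balance and does not affect which of the earlier edges are bridges.\<close>

lemma euler_forest_iff:
  fixes f :: "'e \<Rightarrow> 'v \<times> 'v"
  assumes "finite V" "finite I" "f ` I \<subseteq> V \<times> V"
  shows "card V = card I + card (classes V (f ` I)) \<longleftrightarrow> (\<forall>e\<in>I. f e \<notin> conn (f ` (I - {e})))"
  using assms(2,3)
proof (induction I)
  case empty
  have "classes V (f ` {}) = (\<lambda>v. {v}) ` V" by (auto simp: classes_def conn_def)
  then show ?case by (simp add: card_image)
next
  case (insert e I)
  obtain u v where uv: "f e = (u, v)" by force
  have I: "insert e I - {e} = I" using insert by auto
  show ?case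
  proof (cases "f e \<in> conn (f ` I)")
    case True
    then have "classes V (f ` insert e I) = classes V (f ` I)"
      by (simp add: uv classes_def conn_insert_same)
    \<comment> \<open>This edge raises the edge count but fuses nothing, so equality would violate
      the bound for \<open>I\<close>.\<close>
    then have "card V \<noteq> card (insert e I) + card (classes V (f ` insert e I))"
      using insert card_classes_ge[OF assms(1), of I f] by simp
    then show ?thesis using True I by auto
  next
    case False
    have "card V = card (insert e I) + card (classes V (f ` insert e I)) \<longleftrightarrow>
        (\<forall>e'\<in>I. f e' \<notin> conn (f ` (I - {e'})))"
      using insert uv False card_classes_insert[OF assms(1), of u v "f ` I"] by auto
    also have "\<dots> \<longleftrightarrow> (\<forall>e'\<in>insert e I. f e' \<notin> conn (f ` (insert e I - {e'})))"
    proof -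
      have "f e' \<in> conn (f ` (insert e I - {e'})) \<longleftrightarrow> f e' \<in> conn (f ` (I - {e'}))"
        if "e' \<in> I" for e'
      proof -
        obtain a b where ab: "f e' = (a, b)" by force
        have "insert e I - {e'} = insert e (I - {e'})" using that insert by auto
        then have *: "f ` (insert e I - {e'}) = insert (u, v) (f ` (I - {e'}))" using uv by auto
        have sub: "conn (f ` (I - {e'})) \<subseteq> conn (f ` I)" by (rule conn_mono) auto
        have "(a, b) \<in> conn (f ` I)" using that ab subset_conn by (metis image_eqI subsetD)
        moreover have "(u, v) \<notin> conn (f ` I)" using False uv by simp
        \<comment> \<open>A walk from \<open>a\<close> to \<open>b\<close> through the new edge,
          closed up by \<open>e'\<close> itself, would join \<open>u\<close> to \<open>v\<close> by
          edges of \<open>I\<close>, against the case assumption.\<close>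
        ultimately have "\<not> ((a, u) \<in> conn (f ` I) \<and> (v, b) \<in> conn (f ` I))"
            "\<not> ((a, v) \<in> conn (f ` I) \<and> (u, b) \<in> conn (f ` I))"
          by (meson conn_sym conn_trans)+
        then show ?thesis
          unfolding * ab conn_insert_iff using sub by blast
      qed
      then show ?thesis using False I by auto
    qed
    finally show ?thesis .
  qed
qed

section \<open>Cycles in multigraphs\<close>

lemma conn_iff_rtranclp: "(u, v) \<in> conn E \<longleftrightarrow> (\<lambda>u v. (u, v) \<in> E \<union> E\<inverse>)\<^sup>*\<^sup>* u v"
  by (simp only: conn_def rtrancl_def mem_Collect_eq prod.case)

text \<open>A choice of orientation turns edges into pairs, to which \<open>conn\<close> applies. A
  loop becomes \<open>(u, u)\<close>, which lies in every \<open>conn\<close> and so never counts as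
  a bridge.\<close>

definition orients :: "('e \<Rightarrow> 'v \<times> 'v) \<Rightarrow> ('v, 'e) mgraph \<Rightarrow> bool" where
  "orients f G \<longleftrightarrow> (\<forall>e\<in>edges G. ends G e = {fst (f e), snd (f e)})"

lemma finite_mgraph_orients_ex:
  assumes "finite_mgraph G"
  shows "\<exists>f. orients f G"
proof -
  have "\<exists>p. ends G e = {fst p, snd p}" if "e \<in> edges G" for e
  proof -
    have "card (ends G e) = 1 \<or> card (ends G e) = 2"
      using assms that by (auto simp: finite_mgraph_def)
    then obtain u v where "ends G e = {u, v}"
      by (auto simp: card_1_singleton_iff card_2_iff)
    then have "ends G e = {fst (u, v), snd (u, v)}" by simp
    then show ?thesis by blast
  qed
  then show ?thesis unfolding orients_def by (intro bchoice) blast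
qed

lemma orients_subset:
  assumes "finite_mgraph G" "orients f G"
  shows "f ` edges G \<subseteq> verts G \<times> verts G"
proof
  fix p assume "p \<in> f ` edges G"
  then obtain e where "e \<in> edges G" "p = f e" by blast
  then have "{fst p, snd p} \<subseteq> verts G"
    using assms by (auto simp: finite_mgraph_def orients_def)
  then show "p \<in> verts G \<times> verts G" by (auto simp: mem_Times_iff)
qed

lemma components_eq_classes:
  assumes "orients f G"
  shows "components G = classes (verts G) (f ` edges G)"
proof -
  have "adj G u v \<longleftrightarrow> (u, v) \<in> f ` edges G \<union> (f ` edges G)\<inverse>" for u v
  proof -
    have "ends G e = {u, v} \<longleftrightarrow> f e = (u, v) \<or> f e = (v, u)" if "e \<in> edges G" for e
      using that assms by (cases "f e") (auto simp: orients_def doubleton_eq_iff)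
    then show ?thesis unfolding adj_def by (auto simp: image_iff; metis)
  qed
  then have "adj G = (\<lambda>u v. (u, v) \<in> f ` edges G \<union> (f ` edges G)\<inverse>)" by (intro ext)
  then have "(adj G)\<^sup>*\<^sup>* u v \<longleftrightarrow> (u, v) \<in> conn (f ` edges G)" for u v
    by (simp only: conn_iff_rtranclp)
  then show ?thesis by (auto simp: components_def classes_def)
qed

text \<open>Walks are shortened to simple paths because \<open>is_cycle\<close> asks for distinct
  vertices.\<close>

lemma conn_distinct_path:
  assumes "(x, y) \<in> conn E"
  obtains vs where "vs \<noteq> []" "distinct vs" "hd vs = x" "last vs = y"
    "\<And>i. Suc i < length vs \<Longrightarrow> (vs ! i, vs ! Suc i) \<in> E \<union> E\<inverse>"
proof -
  let ?r = "\<lambda>u v. (u, v) \<in> E \<union> E\<inverse>"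
  have "?r\<^sup>*\<^sup>* x y" using assms unfolding conn_iff_rtranclp .
  then obtain xs where "rtrancl_path ?r x xs y" by (auto simp: rtranclp_eq_rtrancl_path)
  then obtain ys where ys: "rtrancl_path ?r x ys y" "distinct (x # ys)"
    by (rule rtrancl_path_distinct)
  show ?thesis
  proof (rule that[of "x # ys"])
    show "last (x # ys) = y"
      using ys(1) rtrancl_path_last[OF ys(1)] by (cases ys) (auto elim: rtrancl_path.cases)
    show "((x # ys) ! i, (x # ys) ! Suc i) \<in> E \<union> E\<inverse>" if "Suc i < length (x # ys)" for i
      using rtrancl_path_nth[OF ys(1), of i] that by simp
  qed (use ys in auto)
qed

text \<open>Removing one edge of a cycle leaves a path between its ends; conversely, a simple path
  between the ends of \<open>e\<close> that avoids \<open>e\<close> is closed by \<open>e\<close>.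
  This links cycles to the bridge condition of \<open>euler_forest_iff\<close>.\<close>

lemma has_cycle_iff:
  assumes "finite_mgraph G" "orients f G"
  shows "has_cycle G \<longleftrightarrow> (\<exists>e\<in>edges G. f e \<in> conn (f ` (edges G - {e})))"
proof
  assume "has_cycle G"
  then obtain vs es where c: "is_cycle G vs es" by (auto simp: has_cycle_def)
  \<comment> \<open>The last edge is removed: it is the one that wraps around to vertex 0, so the
    others form a path in index order.\<close>
  define k where "k = length es - 1"
  define e where "e = es ! k"
  let ?E = "f ` (edges G - {e})"
  have k: "k < length es" "Suc k mod length es = 0"
    using c by (auto simp: is_cycle_def k_def)
  have e: "e \<in> edges G" using c k by (auto simp: is_cycle_def e_def)
  have ori: "f d = (x, y) \<or> f d = (y, x)" if "d \<in> edges G" "ends G d = {x, y}" for d x y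
    using that assms(2) by (cases "f d") (auto simp: orients_def doubleton_eq_iff)
  have "(vs ! 0, vs ! i) \<in> conn ?E" if "i \<le> k" for i
    using that
  proof (induction i)
    case (Suc i)
    have d: "es ! i \<in> edges G - {e}" "ends G (es ! i) = {vs ! i, vs ! Suc i}"
      using c Suc.prems k by (auto simp: is_cycle_def e_def nth_eq_iff_index_eq)
    then have "f (es ! i) \<in> ?E" "f (es ! i) = (vs ! i, vs ! Suc i) \<or> f (es ! i) = (vs ! Suc i, vs ! i)"
      using ori by auto
    then have "(vs ! i, vs ! Suc i) \<in> conn ?E" using subset_conn conn_sym by (metis subsetD)
    then show ?case using Suc conn_trans by (metis Suc_leD)
  qed simp
  moreover have "f e = (vs ! k, vs ! 0) \<or> f e = (vs ! 0, vs ! k)"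
    using c k e by (intro ori) (auto simp: is_cycle_def e_def)
  ultimately have "f e \<in> conn ?E" using conn_sym by (metis order_refl)
  then show "\<exists>e\<in>edges G. f e \<in> conn (f ` (edges G - {e}))" using e by blast
next
  assume "\<exists>e\<in>edges G. f e \<in> conn (f ` (edges G - {e}))"
  then obtain e where e: "e \<in> edges G" "f e \<in> conn (f ` (edges G - {e}))" by blast
  obtain u v where uv: "f e = (u, v)" by force
  let ?E = "f ` (edges G - {e})"
  from e(2) obtain vs where vs: "vs \<noteq> []" "distinct vs" "hd vs = u" "last vs = v"
    "\<And>i. Suc i < length vs \<Longrightarrow> (vs ! i, vs ! Suc i) \<in> ?E \<union> ?E\<inverse>"
    unfolding uv by (rule conn_distinct_path) blast
  have "\<exists>d. d \<in> edges G - {e} \<and> ends G d = {vs ! i, vs ! Suc i}" if i: "Suc i < length vs" for i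
  proof -
    obtain d where "d \<in> edges G - {e}" "f d = (vs ! i, vs ! Suc i) \<or> f d = (vs ! Suc i, vs ! i)"
      using vs(5)[OF i] by (auto simp: image_iff; metis)
    then show ?thesis using assms(2) by (auto simp: orients_def intro!: exI[of _ d])
  qed
  then obtain g where g: "\<And>i. Suc i < length vs \<Longrightarrow> g i \<in> edges G - {e}"
      "\<And>i. Suc i < length vs \<Longrightarrow> ends G (g i) = {vs ! i, vs ! Suc i}"
    by metis
  define m where "m = length vs - 1"
  have m: "length vs = Suc m" using vs(1) by (simp add: m_def)
  \<comment> \<open>The path edges in order, followed by \<open>e\<close>. For a loop the path is a
    single vertex, \<open>m\<close> is 0 and the cycle is \<open>[e]\<close>.\<close>
  define es where "es = map g [0..<m] @ [e]"
  \<comment> \<open>Different steps of a simple path have different end sets, hence use different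
    edges.\<close>
  have inj: "inj_on g {0..<m}"
  proof (rule inj_onI)
    fix i j assume ij: "i \<in> {0..<m}" "j \<in> {0..<m}" "g i = g j"
    then have "{vs ! i, vs ! Suc i} = {vs ! j, vs ! Suc j}"
      using g(2)[of i] g(2)[of j] m by simp
    then show "i = j"
      using ij m vs(2) by (auto simp: doubleton_eq_iff nth_eq_iff_index_eq)
  qed
  have "set vs \<subseteq> verts G"
  proof
    fix x assume "x \<in> set vs"
    then obtain i where i: "i < Suc m" "x = vs ! i" using m by (auto simp: in_set_conv_nth)
    show "x \<in> verts G"
    proof (cases "i < m")
      case True
      then show ?thesis using g[of i] i m assms(1) by (auto simp: finite_mgraph_def)
    next
      case False
      then have "x = v" using i vs m by (auto simp: last_conv_nth less_Suc_eq)
      then show ?thesis using orients_subset[OF assms] e(1) uv by force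
    qed
  qed
  moreover have "ends G (es ! i) = {vs ! i, vs ! (Suc i mod length es)}" if i: "i < length es" for i
  proof (cases "i < m")
    case True
    then show ?thesis using g(2)[of i] m by (simp add: es_def nth_append)
  next
    case False
    then have "i = m" using i by (simp add: es_def)
    moreover have "vs ! 0 = u" "vs ! m = v" using vs m by (auto simp: hd_conv_nth last_conv_nth)
    ultimately show ?thesis
      using e(1) assms(2) uv by (auto simp: es_def nth_append orients_def)
  qed
  moreover have "distinct es" "set es \<subseteq> edges G"
    using g(1) e(1) m inj by (fastforce simp: es_def distinct_map)+
  ultimately have "is_cycle G vs es"
    using vs(2) m by (auto simp: is_cycle_def es_def)
  then show "has_cycle G" by (auto simp: has_cycle_def)
qed

section \<open>Gluing\<close>

text \<open>Intersecting with \<open>X\<close> is a bijection from the classes of \<open>V\<close>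
  that meet \<open>X\<close> to the classes of \<open>X\<close>, since connecting paths may leave
  \<open>X\<close>.\<close>

lemma card_classes_restrict:
  assumes "finite V" "X \<subseteq> V"
  shows "card (classes V E) = card (classes X E) + card {C \<in> classes V E. C \<inter> X = {}}"
proof -
  let ?c = "\<lambda>x. V \<inter> conn E `` {x}"
  let ?M = "{C \<in> classes V E. C \<inter> X \<noteq> {}}"
  have M: "?M = ?c ` X"
  proof (intro subset_antisym subsetI)
    fix C assume "C \<in> ?M"
    then obtain v x where "C = ?c v" "x \<in> X" "(v, x) \<in> conn E"
      by (auto simp: classes_def)
    then show "C \<in> ?c ` X" using conn_class_eq[of v x E] by auto
  qed (use assms(2) in \<open>force simp: classes_def\<close>)
  have "inj_on (\<lambda>C. C \<inter> X) ?M"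
  proof (rule inj_onI)
    fix C D assume "C \<in> ?M" "D \<in> ?M" and eq: "C \<inter> X = D \<inter> X"
    then obtain x y where xy: "x \<in> X" "y \<in> X" "C = ?c x" "D = ?c y" using M by auto
    have "y \<in> D \<inter> X" using xy assms(2) by auto
    then have "(x, y) \<in> conn E" using eq xy by blast
    then show "C = D" using xy conn_class_eq[of x y E] by simp
  qed
  moreover have "(\<lambda>C. C \<inter> X) ` ?M = classes X E"
  proof -
    have "?c x \<inter> X = X \<inter> conn E `` {x}" for x using assms(2) by auto
    then show ?thesis unfolding M by (simp add: classes_def image_image)
  qed
  ultimately have "card ?M = card (classes X E)"
    using card_image[of "\<lambda>C. C \<inter> X" ?M] by simp
  moreover have "card (classes V E) = card ?M + card {C \<in> classes V E. C \<inter> X = {}}"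
  proof -
    have "classes V E = ?M \<union> {C \<in> classes V E. C \<inter> X = {}}" by blast
    moreover have "card \<dots> = card ?M + card {C \<in> classes V E. C \<inter> X = {}}"
      using finite_classes[OF assms(1), of E] by (intro card_Un_disjoint) auto
    ultimately show ?thesis by simp
  qed
  ultimately show ?thesis by simp
qed

lemma conn_Int_eq_Union_classes: "conn E \<inter> X \<times> X = (\<Union>S\<in>classes X E. S \<times> S)"
proof (intro subset_antisym subrelI)
  fix x y assume "(x, y) \<in> conn E \<inter> X \<times> X"
  then show "(x, y) \<in> (\<Union>S\<in>classes X E. S \<times> S)"
    by (auto simp: classes_def intro!: bexI[of _ x])
next
  fix x y assume "(x, y) \<in> (\<Union>S\<in>classes X E. S \<times> S)"
  then obtain v where "(v, x) \<in> conn E" "(v, y) \<in> conn E" "x \<in> X" "y \<in> X"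
    by (auto simp: classes_def)
  then show "(x, y) \<in> conn E \<inter> X \<times> X" using conn_sym conn_trans by fast
qed

lemma conn_closed:
  assumes "(x, y) \<in> conn E" "E \<subseteq> V \<times> V" "x \<in> V"
  shows "y \<in> V"
  using assms(1) by (induction rule: conn_induct) (use assms(2,3) in auto)

text \<open>A walk can change sides only at a vertex of \<open>X\<close>. Cut there, it becomes a
  sequence of connections within one side between vertices of \<open>X\<close>, so on
  \<open>X\<close> only the two induced partitions matter.\<close>

lemma classes_glue:
  assumes "E1 \<subseteq> V1 \<times> V1" "E2 \<subseteq> V2 \<times> V2" "X = V1 \<inter> V2"
  shows "classes X (E1 \<union> E2) = classes X ((\<Union>S\<in>classes X E1. S \<times> S) \<union> (\<Union>S\<in>classes X E2. S \<times> S))"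
proof -
  let ?R = "conn E1 \<inter> X \<times> X \<union> conn E2 \<inter> X \<times> X"
  have sub: "conn E1 \<subseteq> conn (E1 \<union> E2)" "conn E2 \<subseteq> conn (E1 \<union> E2)"
    by (rule conn_mono; simp)+
  have "(x, y) \<in> conn ?R" if "(x, y) \<in> conn (E1 \<union> E2)" "x \<in> X" "y \<in> X" for x y
  proof -
    \<comment> \<open>Invariant of the walk: \<open>z\<close> is a vertex of \<open>X\<close>
      reached by links within \<open>X\<close>, and the current vertex is connected to
      \<open>z\<close> on one side alone. When the side changes, the current vertex lies in
      \<open>X\<close> and replaces \<open>z\<close>.\<close>
    from that(1) have "\<exists>z\<in>X. (x, z) \<in> conn ?R \<and> ((z, y) \<in> conn E1 \<or> (z, y) \<in> conn E2)"
    proof (induction rule: conn_induct)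
      case base
      show ?case using that(2) by (intro bexI[of _ x]) auto
    next
      case (step y w)
      then obtain z where z: "z \<in> X" "(x, z) \<in> conn ?R" "(z, y) \<in> conn E1 \<or> (z, y) \<in> conn E2"
        by blast
      have yw: "(y, w) \<in> conn E1 \<and> y \<in> V1 \<or> (y, w) \<in> conn E2 \<and> y \<in> V2"
        using step.hyps(2) subset_conn[of E1] subset_conn[of E2] conn_sym assms(1,2) by fast
      have y: "(z, y) \<in> conn E1 \<Longrightarrow> y \<in> V1" "(z, y) \<in> conn E2 \<Longrightarrow> y \<in> V2"
        using conn_closed assms z(1) by (metis IntD1 IntD2)+
      have "(z, w) \<in> conn E1 \<or> (z, w) \<in> conn E2 \<or> y \<in> X"
        using z(3) yw y conn_trans assms(3) by (metis IntI)
      moreover have "(x, y) \<in> conn ?R" if "y \<in> X"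
      proof -
        have "(z, y) \<in> ?R" using that z by blast
        then show ?thesis by (rule conn_trans[OF z(2) conn_edge])
      qed
      ultimately show ?case
      proof (elim disjE)
        assume y: "y \<in> X" and "y \<in> X \<Longrightarrow> (x, y) \<in> conn ?R"
        then show ?thesis using yw by (intro bexI[OF _ y]) blast
      qed (use z(1,2) in \<open>intro bexI[OF _ z(1)]; blast\<close>)+
    qed
    then obtain z where z: "z \<in> X" "(x, z) \<in> conn ?R" "(z, y) \<in> conn E1 \<or> (z, y) \<in> conn E2"
      by blast
    then have "(z, y) \<in> ?R" using that(3) by blast
    then show ?thesis by (rule conn_trans[OF z(2) conn_edge])
  qed
  moreover have "conn ?R \<subseteq> conn (E1 \<union> E2)"
    using sub by (intro conn_minimal) auto
  ultimately have "X \<inter> conn (E1 \<union> E2) `` {x} = X \<inter> conn ?R `` {x}" if "x \<in> X" for x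
    using that by auto
  then show ?thesis
    unfolding conn_Int_eq_Union_classes[symmetric] by (simp add: classes_def)
qed

text \<open>By \<open>card_classes_restrict\<close> it suffices to count classes that avoid
  \<open>X\<close>, and those of the union are exactly those of the two sides. The terms are
  arranged so that no subtraction occurs.\<close>

lemma card_classes_glue:
  assumes "finite V1" "finite V2" "E1 \<subseteq> V1 \<times> V1" "E2 \<subseteq> V2 \<times> V2" "X = V1 \<inter> V2"
  shows "card (classes (V1 \<union> V2) (E1 \<union> E2)) + card (classes X E1) + card (classes X E2) =
    card (classes X (E1 \<union> E2)) + card (classes V1 E1) + card (classes V2 E2)"
proof -
  let ?F = "\<lambda>V E. {C \<in> classes V E. C \<inter> X = {}}"
  \<comment> \<open>A class of one side that avoids \<open>X\<close> never reaches the other side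
    and cannot grow. The sets are quantified afresh so that the two sides can be exchanged.\<close>
  have *: "(V1 \<union> V2) \<inter> conn (E1 \<union> E2) `` {v} = V1 \<inter> conn E1 `` {v}"
    if "v \<in> V1" "conn E1 `` {v} \<inter> X = {}" "E1 \<subseteq> V1 \<times> V1" "E2 \<subseteq> V2 \<times> V2" "X = V1 \<inter> V2"
    for v :: 'a and V1 V2 E1 E2
  proof -
    have "y \<in> V1 \<inter> conn E1 `` {v}" if "(v, y) \<in> conn (E1 \<union> E2)" for y
      using that
    proof (induction rule: conn_induct)
      case (step y z)
      then have "y \<notin> V2" using \<open>conn E1 `` {v} \<inter> X = {}\<close> \<open>X = V1 \<inter> V2\<close> by blast
      then have "(y, z) \<in> E1 \<or> (z, y) \<in> E1" using step.hyps(2) \<open>E2 \<subseteq> V2 \<times> V2\<close> by blast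
      then show ?case
        using step.IH subset_conn[of E1] conn_sym[of z y E1] conn_trans[of v y E1 z] \<open>E1 \<subseteq> V1 \<times> V1\<close>
        by blast
    qed (use \<open>v \<in> V1\<close> in simp)
    moreover have "conn E1 \<subseteq> conn (E1 \<union> E2)" by (rule conn_mono) auto
    ultimately show ?thesis by blast
  qed
  have sub: "?F V1 E1 \<subseteq> ?F (V1 \<union> V2) (E1 \<union> E2)"
    if "E1 \<subseteq> V1 \<times> V1" "E2 \<subseteq> V2 \<times> V2" "X = V1 \<inter> V2" for V1 V2 E1 E2
  proof
    fix C assume C: "C \<in> ?F V1 E1"
    then obtain v where v: "v \<in> V1" "C = V1 \<inter> conn E1 `` {v}" by (auto simp: classes_def)
    then have "conn E1 `` {v} \<inter> X = {}" using C that(3) by blast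
    from *[OF v(1) this that] v have "C = (V1 \<union> V2) \<inter> conn (E1 \<union> E2) `` {v}" by simp
    then show "C \<in> ?F (V1 \<union> V2) (E1 \<union> E2)" using C v(1) by (auto simp: classes_def)
  qed
  have sup: "C \<in> ?F V1 E1"
    if "C \<in> ?F (V1 \<union> V2) (E1 \<union> E2)" "C = (V1 \<union> V2) \<inter> conn (E1 \<union> E2) `` {v}" "v \<in> V1"
      "E1 \<subseteq> V1 \<times> V1" "E2 \<subseteq> V2 \<times> V2" "X = V1 \<inter> V2" for C v V1 V2 E1 E2
  proof -
    have "conn E1 \<subseteq> conn (E1 \<union> E2)" by (rule conn_mono) auto
    then have "conn E1 `` {v} \<inter> X = {}" using that(1,2,6) by blast
    from *[OF that(3) this that(4-6)] show ?thesis using that(1-3) by (auto simp: classes_def)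
  qed
  have "?F (V1 \<union> V2) (E1 \<union> E2) = ?F V1 E1 \<union> ?F V2 E2"
  proof (intro subset_antisym Un_least)
    show "?F (V1 \<union> V2) (E1 \<union> E2) \<subseteq> ?F V1 E1 \<union> ?F V2 E2"
    proof
      fix C assume C: "C \<in> ?F (V1 \<union> V2) (E1 \<union> E2)"
      then obtain v where v: "v \<in> V1 \<union> V2" "C = (V1 \<union> V2) \<inter> conn (E1 \<union> E2) `` {v}"
        by (auto simp: classes_def)
      show "C \<in> ?F V1 E1 \<union> ?F V2 E2"
      proof (cases "v \<in> V1")
        case True
        then show ?thesis using sup[OF C v(2)] assms(3-5) by blast
      next
        case False
        have "C \<in> ?F (V2 \<union> V1) (E2 \<union> E1)" "C = (V2 \<union> V1) \<inter> conn (E2 \<union> E1) `` {v}"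
          using C v(2) by (simp_all add: Un_commute)
        then show ?thesis using sup[of C V2 V1 E2 E1 v] False v(1) assms(3-5) by blast
      qed
    qed
    show "?F V1 E1 \<subseteq> ?F (V1 \<union> V2) (E1 \<union> E2)" using sub assms by blast
    show "?F V2 E2 \<subseteq> ?F (V1 \<union> V2) (E1 \<union> E2)"
      using sub[of E2 V2 E1 V1] assms by (simp add: Un_commute Int_commute)
  qed
  moreover have "?F V1 E1 \<inter> ?F V2 E2 = {}"
  proof -
    have "C \<noteq> {}" "C \<subseteq> V" if "C \<in> classes V E" for C :: "'a set" and V E
      using that by (auto simp: classes_def)
    then have "C \<inter> X \<noteq> {}" if "C \<in> classes V1 E1" "C \<in> classes V2 E2" for C
      using that assms(5) by (metis Int_absorb2 Int_greatest)
    then show ?thesis by auto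
  qed
  ultimately have "card (?F (V1 \<union> V2) (E1 \<union> E2)) = card (?F V1 E1) + card (?F V2 E2)"
    using assms(1,2) by (simp add: card_Un_disjoint finite_classes)
  moreover have "X \<subseteq> V1 \<union> V2" "X \<subseteq> V1" "X \<subseteq> V2" using assms(5) by auto
  ultimately show ?thesis
    using card_classes_restrict[of "V1 \<union> V2" X "E1 \<union> E2"] card_classes_restrict[of V1 X E1]
      card_classes_restrict[of V2 X E2] assms(1,2) by simp
qed

section \<open>The join of two partitions and the Euler count of a glue\<close>

definition block_rel :: "'a set set \<Rightarrow> 'a rel" where
  "block_rel \<pi> = (\<Union>S\<in>\<pi>. S \<times> S)"

text \<open>For partitions of \<open>{1..n}\<close>, this is the number of blocks of their join in
  the partition lattice.\<close>

definition join_card :: "nat \<Rightarrow> nat set set \<Rightarrow> nat set set \<Rightarrow> nat" where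
  "join_card n \<pi> \<rho> = card (classes {1..n} (block_rel \<pi> \<union> block_rel \<rho>))"

text \<open>Each block is the trace of a component on the boundary by definition; since the blocks
  cover the boundary, there are no further traces.\<close>

lemma classes_representative_forest:
  fixes G :: "(nat + 'u, 'e) mgraph"
  assumes "representative_forest n \<pi> G" "partition_on {1..n} \<pi>" "orients f G"
  shows "classes (Inl ` {1..n}) (f ` edges G) = (`) Inl ` \<pi>"
proof -
  let ?X = "Inl ` {1..n} :: (nat + 'u) set" and ?E = "f ` edges G"
  have X: "?X \<subseteq> verts G" using assms(1) unfolding representative_forest_def by blast
  have block: "Inl ` S = ?X \<inter> conn ?E `` {Inl x}" if "S \<in> \<pi>" "x \<in> S" for S x
  proof -
    obtain C where C: "C \<in> components G" "C \<inter> ?X = Inl ` S"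
      using assms(1) \<open>S \<in> \<pi>\<close> by (auto simp: representative_forest_def)
    then obtain v where v: "C = verts G \<inter> conn ?E `` {v}"
      by (auto simp: components_eq_classes[OF assms(3)] classes_def)
    have "Inl x \<in> C" using C(2) that(2) by blast
    then have "conn ?E `` {v} = conn ?E `` {Inl x}" using v by (intro conn_class_eq) auto
    then show ?thesis using C(2) v X by blast
  qed
  show ?thesis
  proof (intro subset_antisym subsetI)
    fix C assume "C \<in> classes ?X ?E"
    then obtain x where x: "x \<in> {1..n}" "C = ?X \<inter> conn ?E `` {Inl x}"
      by (auto simp: classes_def)
    moreover obtain S where "S \<in> \<pi>" "x \<in> S" using x(1) partition_onD1[OF assms(2)] by blast
    ultimately show "C \<in> (`) Inl ` \<pi>" using block[of S x] by (metis image_eqI)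
  next
    fix C :: "(nat + 'u) set" assume "C \<in> (`) Inl ` \<pi>"
    then obtain S where S: "S \<in> \<pi>" "C = Inl ` S" by blast
    then have "S \<noteq> {}" "S \<subseteq> {1..n}"
      using partition_onD1[OF assms(2)] partition_onD3[OF assms(2)] by auto
    then obtain x where "x \<in> S" "x \<in> {1..n}" by blast
    then show "C \<in> classes ?X ?E" using S block[of S x] by (auto simp: classes_def)
  qed
qed

lemma forest_euler:
  assumes "forest G" "orients f G"
  shows "card (verts G) = card (edges G) + card (classes (verts G) (f ` edges G))"
  using assms has_cycle_iff[of G f] orients_subset[of G f]
    euler_forest_iff[of "verts G" "edges G" f]
  by (auto simp: forest_def finite_mgraph_def)

lemma finite_mgraph_glue:
  fixes G :: "('b + 'u, 'e) mgraph" and H :: "('b + 'v, 'f) mgraph"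
  assumes "finite_mgraph G" "finite_mgraph H"
  shows "finite_mgraph (glue G H)"
proof -
  have "inj (map_sum id Inl :: 'b + 'u \<Rightarrow> 'b + 'u + 'v)"
      "inj (map_sum id Inr :: 'b + 'v \<Rightarrow> 'b + 'u + 'v)"
    by (auto simp: sum.inj_map)
  then have "card (map_sum id Inl ` A :: ('b + 'u + 'v) set) = card A"
      "card (map_sum id Inr ` B :: ('b + 'u + 'v) set) = card B"
    for A :: "('b + 'u) set" and B :: "('b + 'v) set"
    by (meson card_image inj_on_subset subset_UNIV)+
  then show ?thesis
    using assms by (fastforce simp: finite_mgraph_def glue_def)
qed

lemma card_image_image: "inj f \<Longrightarrow> card ((`) f ` \<A>) = card \<A>"
  by (intro card_image inj_onI) (simp add: inj_image_eq_iff)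

text \<open>The glue has \<open>n\<close> fewer vertices than \<open>G\<close> and \<open>H\<close>
  together, the sum of their edges, and a number of components given by
  \<open>card_classes_glue\<close>. Subtracting the Euler formulas of both forests removes
  everything but the partitions, so the outcome is independent of the representatives.\<close>

lemma glue_euler:
  fixes G :: "(nat + 'u, 'e) mgraph" and H :: "(nat + 'v, 'f) mgraph"
  assumes \<pi>: "partition_on {1..n} \<pi>" and \<rho>: "partition_on {1..n} \<rho>"
    and G: "representative_forest n \<pi> G" and H: "representative_forest n \<rho> H"
  shows "card \<pi> + card \<rho> \<le> n + join_card n \<pi> \<rho>"
    and "has_cycle (glue G H) \<longleftrightarrow> card \<pi> + card \<rho> \<noteq> n + join_card n \<pi> \<rho>"
proof -
  have fG: "forest G" "finite_mgraph G" and fH: "forest H" "finite_mgraph H"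
    using G H by (auto simp: representative_forest_def forest_def)
  obtain f g where f: "orients f G" and g: "orients g H"
    using finite_mgraph_orients_ex fG fH by metis
  define h1 :: "nat + 'u \<Rightarrow> nat + 'u + 'v" where "h1 = map_sum id Inl"
  define h2 :: "nat + 'v \<Rightarrow> nat + 'u + 'v" where "h2 = map_sum id Inr"
  have inj: "inj h1" "inj h2" by (auto simp: h1_def h2_def sum.inj_map)
  have h: "h1 (Inl x) = Inl x" "h2 (Inl x) = Inl x" for x
    by (simp_all add: h1_def h2_def)
  let ?X = "Inl ` {1..n} :: (nat + 'u + 'v) set"
  define V1 where "V1 = h1 ` verts G"
  define V2 where "V2 = h2 ` verts H"
  define E1 where "E1 = map_prod h1 h1 ` f ` edges G"
  define E2 where "E2 = map_prod h2 h2 ` g ` edges H"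
  define k where "k = case_sum (map_prod h1 h1 \<circ> f) (map_prod h2 h2 \<circ> g)"
  have V: "verts (glue G H) = V1 \<union> V2"
    by (simp add: glue_def V1_def V2_def h1_def h2_def)
  have E: "k ` edges (glue G H) = E1 \<union> E2"
    by (simp add: glue_def E1_def E2_def k_def Plus_def image_Un image_image)
  have k: "orients k (glue G H)"
    using f g by (auto simp: orients_def glue_def k_def h1_def h2_def)
  \<comment> \<open>Names of non-boundary vertices get different tags, so the two copies meet
    exactly in the boundary.\<close>
  have X: "?X = V1 \<inter> V2"
  proof -
    obtain A where "verts G = Inl ` {1..n} \<union> Inr ` A"
      using G unfolding representative_forest_def by (elim conjE exE)
    moreover obtain B where "verts H = Inl ` {1..n} \<union> Inr ` B"
      using H unfolding representative_forest_def by (elim conjE exE)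
    ultimately have "V1 = ?X \<union> Inr ` Inl ` A" "V2 = ?X \<union> Inr ` Inr ` B"
      by (simp_all add: V1_def V2_def image_Un image_image h1_def h2_def)
    then show ?thesis by auto
  qed
  have sub: "E1 \<subseteq> V1 \<times> V1" "E2 \<subseteq> V2 \<times> V2"
    using orients_subset[OF fG(2) f] orients_subset[OF fH(2) g]
    by (force simp: E1_def E2_def V1_def V2_def)+
  have fin: "finite V1" "finite V2" "finite (edges G)" "finite (edges H)"
    using fG fH by (auto simp: V1_def V2_def finite_mgraph_def)
  have c1: "classes ?X E1 = (`) Inl ` \<pi>"
    using classes_image[OF inj(1), of "Inl ` {1..n}" "f ` edges G"]
      classes_representative_forest[OF G \<pi> f] by (simp add: E1_def h image_image)
  have c2: "classes ?X E2 = (`) Inl ` \<rho>"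
    using classes_image[OF inj(2), of "Inl ` {1..n}" "g ` edges H"]
      classes_representative_forest[OF H \<rho> g] by (simp add: E2_def h image_image)
  have card_Inl: "card ((`) Inl ` \<A> :: (nat + 'u + 'v) set set) = card \<A>" for \<A>
    by (rule card_image_image) simp
  have j: "card (classes ?X (E1 \<union> E2)) = join_card n \<pi> \<rho>"
  proof -
    have "(\<Union>S\<in>(`) Inl ` \<A>. S \<times> S :: (nat + 'u + 'v) rel) = map_prod Inl Inl ` block_rel \<A>" for \<A> :: "nat set set"
      by (force simp: block_rel_def)
    then have "classes ?X (E1 \<union> E2) = (`) Inl ` classes {1..n} (block_rel \<pi> \<union> block_rel \<rho>)"
      unfolding classes_glue[OF sub X] c1 c2 by (simp add: classes_image[symmetric] image_Un)
    then show ?thesis by (simp add: join_card_def card_Inl)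
  qed
  have l1: "card (classes V1 E1) = card (classes (verts G) (f ` edges G))"
    using inj(1) by (simp add: V1_def E1_def classes_image card_image_image)
  have l2: "card (classes V2 E2) = card (classes (verts H) (g ` edges H))"
    using inj(2) by (simp add: V2_def E2_def classes_image card_image_image)
  have "card V1 = card (verts G)" "card V2 = card (verts H)"
    unfolding V1_def V2_def using inj by (meson card_image inj_on_subset subset_UNIV)+
  moreover have "card ?X = n" by (simp add: card_image)
  ultimately have cV: "card (V1 \<union> V2) + n = card (verts G) + card (verts H)"
    using card_Un_Int[OF fin(1,2)] X by simp
  have cE: "card (edges (glue G H)) = card (edges G) + card (edges H)"
    using fin by (simp add: glue_def card_Plus)
  have c: "card (classes (V1 \<union> V2) (E1 \<union> E2)) + card \<pi> + card \<rho> =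
      join_card n \<pi> \<rho> + card (classes (verts G) (f ` edges G)) + card (classes (verts H) (g ` edges H))"
    using card_classes_glue[OF fin(1,2) sub X] unfolding c1 c2 card_Inl j l1 l2 .
  have fin': "finite (edges (glue G H))" using fin by (simp add: glue_def)
  have sub': "k ` edges (glue G H) \<subseteq> (V1 \<union> V2) \<times> (V1 \<union> V2)" using sub E by auto
  have "card (V1 \<union> V2) \<le> card (edges (glue G H)) + card (classes (V1 \<union> V2) (E1 \<union> E2))"
    using card_classes_ge[OF _ fin' sub'] fin E by simp
  then show "card \<pi> + card \<rho> \<le> n + join_card n \<pi> \<rho>"
    using cV cE c forest_euler[OF fG(1) f] forest_euler[OF fH(1) g] by linarith
  have "\<not> has_cycle (glue G H) \<longleftrightarrow>
      card (V1 \<union> V2) = card (edges (glue G H)) + card (classes (V1 \<union> V2) (E1 \<union> E2))"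
    using has_cycle_iff[OF finite_mgraph_glue[OF fG(2) fH(2)] k] euler_forest_iff[OF _ fin' sub'] fin E
    by auto
  then show "has_cycle (glue G H) \<longleftrightarrow> card \<pi> + card \<rho> \<noteq> n + join_card n \<pi> \<rho>"
    using cV cE c forest_euler[OF fG(1) f] forest_euler[OF fH(1) g] by linarith
qed

section \<open>Existence of representative forests\<close>

definition block_min :: "nat set set \<Rightarrow> nat \<Rightarrow> nat" where
  "block_min \<pi> i = Min (THE S. S \<in> \<pi> \<and> i \<in> S)"

text \<open>Disjointness of the blocks makes the description in \<open>block_min\<close> unique. The
  minimum serves as the centre of a star and later as a sort key that keeps blocks together.\<close>

lemma block_min_eq:
  assumes "partition_on X \<pi>" "S \<in> \<pi>" "i \<in> S"
  shows "block_min \<pi> i = Min S"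
proof -
  have "(THE S. S \<in> \<pi> \<and> i \<in> S) = S"
    using assms by (intro the_equality) (auto simp: partition_on_def disjoint_def)
  then show ?thesis by (simp add: block_min_def)
qed

text \<open>Every block becomes a star centred at its minimum; an edge is named by its other end.\<close>

lemma representative_forest_ex:
  assumes "partition_on {1..n} \<pi>"
  shows "\<exists>G :: (nat + nat, nat) mgraph. representative_forest n \<pi> G"
proof -
  define m where "m = block_min \<pi>"
  have m: "m i = Min S" if "S \<in> \<pi>" "i \<in> S" for i S
    using block_min_eq[OF assms that] by (simp add: m_def)
  have S: "S \<subseteq> {1..n}" "finite S" "S \<noteq> {}" if "S \<in> \<pi>" for S
    using that assms finite_subset[of S "{1..n}"] by (auto simp: partition_on_def)
  have m_in: "m i \<in> S" if "S \<in> \<pi>" "i \<in> S" for i S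
    using m[OF that] Min_in[of S] S[OF that(1)] by simp
  have cover: "\<exists>S\<in>\<pi>. i \<in> S" if "i \<in> {1..n}" for i
    using that partition_onD1[OF assms] by blast
  define G :: "(nat + nat, nat) mgraph" where
    "G = \<lparr>verts = Inl ` {1..n}, edges = {i\<in>{1..n}. m i \<noteq> i}, ends = (\<lambda>i. {Inl i, Inl (m i)})\<rparr>"
  define f :: "nat \<Rightarrow> (nat + nat) \<times> (nat + nat)" where "f i = (Inl i, Inl (m i))" for i
  have fin: "finite_mgraph G"
    using cover m_in S(1) by (force simp: finite_mgraph_def G_def)
  have f: "orients f G" by (auto simp: orients_def G_def f_def)
  have "f i \<notin> conn (f ` (edges G - {i}))" if "i \<in> edges G" for i
  proof
    \<comment> \<open>A vertex with an edge of its own is not the minimum of its block, so it is no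
      centre. Without that edge it is isolated, and a walk from it cannot move.\<close>
    have not_min: "m j \<noteq> i" if "j \<in> {1..n}" for j
    proof
      assume ji: "m j = i"
      obtain T where "T \<in> \<pi>" "j \<in> T" using cover \<open>j \<in> {1..n}\<close> by blast
      then have "i = Min T" "i \<in> T" using ji m m_in by auto
      then have "m i = i" using m[OF \<open>T \<in> \<pi>\<close>] by simp
      then show False using \<open>i \<in> edges G\<close> by (simp add: G_def)
    qed
    assume "f i \<in> conn (f ` (edges G - {i}))"
    then have "(Inl i, Inl (m i)) \<in> conn (f ` (edges G - {i}))" by (simp add: f_def)
    then have "Inl (m i) = (Inl i :: nat + nat)"
      by (induction rule: conn_induct) (use not_min in \<open>auto simp: f_def G_def\<close>)
    then show False using that by (simp add: G_def)
  qed
  then have "forest G" using has_cycle_iff[OF fin f] fin by (auto simp: forest_def)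
  moreover have "\<exists>C\<in>components G. C \<inter> Inl ` {1..n} = Inl ` S" if "S \<in> \<pi>" for S
  proof -
    have "\<exists>x. x \<in> S" using S(3)[OF that] by blast
    then obtain x where x: "x \<in> S" ..
    have to_min: "(Inl y, Inl (Min S)) \<in> conn (f ` edges G)" if "y \<in> S" for y
    proof (cases "m y = y")
      case True
      then show ?thesis using m[OF \<open>S \<in> \<pi>\<close> that] by simp
    next
      case False
      then have "y \<in> edges G" using S(1)[OF \<open>S \<in> \<pi>\<close>] that by (auto simp: G_def)
      then show ?thesis using m[OF \<open>S \<in> \<pi>\<close> that] by (intro conn_edge) (force simp: f_def)
    qed
    have "z \<in> Inl ` S" if "(Inl x, z) \<in> conn (f ` edges G)" for z
      using that
    proof (induction rule: conn_induct)
      case (step y z)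
      then obtain i where i: "i \<in> {1..n}" "y = Inl i \<and> z = Inl (m i) \<or> z = Inl i \<and> y = Inl (m i)"
        by (auto simp: f_def G_def)
      obtain T where T: "T \<in> \<pi>" "i \<in> T" using cover i by blast
      then have "m i \<in> T" using m_in by blast
      then have "T = S"
        using step.IH i(2) T \<open>S \<in> \<pi>\<close> assms by (auto simp: partition_on_def disjoint_def)
      then show ?case using i(2) T(2) \<open>m i \<in> T\<close> by auto
    qed (use x in simp)
    moreover have "(Inl x, Inl y) \<in> conn (f ` edges G)" if "y \<in> S" for y
      using to_min[OF x] to_min[OF that] conn_sym conn_trans by metis
    ultimately have "verts G \<inter> conn (f ` edges G) `` {Inl x} = Inl ` S"
      using S(1)[OF that] by (auto simp: G_def)
    moreover have "Inl x \<in> verts G" using x S(1)[OF that] by (auto simp: G_def)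
    ultimately have "Inl ` S \<in> components G"
      by (auto simp: components_eq_classes[OF f] classes_def)
    then show ?thesis using S(1)[OF that] by (intro bexI[of _ "Inl ` S"]) auto
  qed
  moreover have "\<exists>V. verts G = Inl ` {1..n} \<union> Inr ` V" by (intro exI[of _ "{}"]) (simp add: G_def)
  ultimately show ?thesis by (auto simp: representative_forest_def)
qed

text \<open>A statement about partitions alone (semimodularity of the partition lattice), read off
  from any pair of representatives.\<close>

lemma join_card_ge:
  assumes "partition_on {1..n} \<pi>" "partition_on {1..n} \<rho>"
  shows "card \<pi> + card \<rho> \<le> n + join_card n \<pi> \<rho>"
  using representative_forest_ex[OF assms(1)] representative_forest_ex[OF assms(2)]
    glue_euler(1)[OF assms] by blast

text \<open>\<open>glue_euler\<close> gives the same answer for all representatives, so the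
  existential in \<open>induce_cycle\<close> is settled by any one pair.\<close>

lemma induce_cycle_iff:
  assumes "partition_on {1..n} \<pi>" "partition_on {1..n} \<rho>"
  shows "induce_cycle n \<pi> \<rho> \<longleftrightarrow> card \<pi> + card \<rho> \<noteq> n + join_card n \<pi> \<rho>"
  using representative_forest_ex[OF assms(1)] representative_forest_ex[OF assms(2)]
    glue_euler(2)[OF assms] unfolding induce_cycle_def by blast

section \<open>Merging blocks\<close>

definition join_rel :: "'a set set \<Rightarrow> 'a set set \<Rightarrow> 'a rel" where
  "join_rel \<pi> \<rho> = conn (block_rel \<pi> \<union> block_rel \<rho>)"

text \<open>Turns the equivalence into an equality, so that symmetry and transitivity are handled by
  equational reasoning.\<close>

lemma join_rel_class_iff: "(x, y) \<in> join_rel \<pi> \<rho> \<longleftrightarrow> join_rel \<pi> \<rho> `` {x} = join_rel \<pi> \<rho> `` {y}"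
proof
  assume "join_rel \<pi> \<rho> `` {x} = join_rel \<pi> \<rho> `` {y}"
  moreover have "y \<in> join_rel \<pi> \<rho> `` {y}" by (simp add: join_rel_def)
  ultimately show "(x, y) \<in> join_rel \<pi> \<rho>" by blast
qed (simp add: join_rel_def conn_class_eq)

lemma partition_on_merge:
  assumes "partition_on X (insert A (insert B \<sigma>))" "A \<noteq> B" "A \<notin> \<sigma>" "B \<notin> \<sigma>"
  shows "partition_on X (insert (A \<union> B) \<sigma>)" "A \<union> B \<notin> \<sigma>"
proof -
  have *: "A \<inter> B = {}" "S \<in> \<sigma> \<Longrightarrow> A \<inter> S = {}" "S \<in> \<sigma> \<Longrightarrow> B \<inter> S = {}" "A \<noteq> {}" "B \<noteq> {}" for S
    using assms by (auto simp: partition_on_def disjoint_def)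
  show "A \<union> B \<notin> \<sigma>"
  proof
    assume "A \<union> B \<in> \<sigma>"
    then show False using *(2)[of "A \<union> B"] *(4) by auto
  qed
  have "disjoint \<sigma>" "{} \<notin> \<sigma>" "X = A \<union> B \<union> \<Union>\<sigma>"
    using assms(1) by (auto simp: partition_on_def disjoint_def)
  then show "partition_on X (insert (A \<union> B) \<sigma>)"
    using *(2-4) by (intro partition_onI) (auto simp: disjnt_def disjoint_def)
qed

text \<open>The shapes 2+2, 3+1 and 4; all other merges of four blocks arise by permuting the
  arguments.\<close>

lemma partition_on_merge4:
  assumes part: "partition_on X (insert A (insert B (insert C (insert D \<sigma>))))"
    and new: "distinct [A, B, C, D]" "A \<notin> \<sigma>" "B \<notin> \<sigma>" "C \<notin> \<sigma>" "D \<notin> \<sigma>"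
  shows "partition_on X (insert (A \<union> B) (insert (C \<union> D) \<sigma>))"
    and "partition_on X (insert (A \<union> B \<union> C) (insert D \<sigma>))"
    and "partition_on X (insert (A \<union> B \<union> C \<union> D) \<sigma>)"
proof -
  have AB: "A \<noteq> B" "A \<notin> insert C (insert D \<sigma>)" "B \<notin> insert C (insert D \<sigma>)" using new by auto
  note AB = partition_on_merge[OF part AB]
  have "partition_on X (insert C (insert D (insert (A \<union> B) \<sigma>)))"
    using AB(1) by (simp add: insert_commute)
  moreover have "C \<noteq> D" "C \<notin> insert (A \<union> B) \<sigma>" "D \<notin> insert (A \<union> B) \<sigma>" using AB(2) new by auto
  ultimately have "partition_on X (insert (C \<union> D) (insert (A \<union> B) \<sigma>))" by (rule partition_on_merge)
  then show "partition_on X (insert (A \<union> B) (insert (C \<union> D) \<sigma>))" by (simp only: insert_commute)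
  have "A \<union> B \<noteq> C" "A \<union> B \<notin> insert D \<sigma>" "C \<notin> insert D \<sigma>" using AB(2) new by auto
  note ABC = partition_on_merge[OF AB(1) this]
  show "partition_on X (insert (A \<union> B \<union> C) (insert D \<sigma>))" by (rule ABC(1))
  show "partition_on X (insert (A \<union> B \<union> C \<union> D) \<sigma>)"
    using partition_on_merge(1)[OF ABC(1)] ABC(2) new(5) by blast
qed

text \<open>For connectivity, merging two blocks amounts to adding a single edge between arbitrary
  representatives.\<close>

lemma conn_block_rel_merge:
  assumes "a \<in> A" "b \<in> B"
  shows "conn (block_rel (insert (A \<union> B) \<sigma>) \<union> R) =
    conn (insert (a, b) (block_rel (insert A (insert B \<sigma>)) \<union> R))" (is "conn ?L = conn ?R")
proof (rule conn_eqI)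
  show "?R \<subseteq> conn ?L"
    using assms by (intro subset_trans[OF _ subset_conn]) (auto simp: block_rel_def)
  have A: "(x, a) \<in> conn ?R" if "x \<in> A" for x
    using that assms by (intro conn_edge) (auto simp: block_rel_def)
  have ab: "(a, b) \<in> conn ?R" by (intro conn_edge) simp
  have B: "(x, a) \<in> conn ?R" if "x \<in> B" for x
  proof -
    have "(x, b) \<in> conn ?R" using that assms by (intro conn_edge) (auto simp: block_rel_def)
    then show ?thesis using ab by (meson conn_sym conn_trans)
  qed
  have "(x, y) \<in> conn ?R" if "x \<in> A \<union> B" "y \<in> A \<union> B" for x y
    using A B that by (meson UnE conn_sym conn_trans)
  moreover have "block_rel \<sigma> \<union> R \<subseteq> conn ?R"
    by (intro subset_trans[OF _ subset_conn]) (auto simp: block_rel_def)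
  ultimately show "?L \<subseteq> conn ?R" by (auto simp: block_rel_def)
qed

lemma join_rel_merge_iff:
  assumes "a \<in> A" "b \<in> B"
  shows "(x, y) \<in> join_rel (insert (A \<union> B) \<sigma>) \<rho> \<longleftrightarrow>
    (let J = join_rel (insert A (insert B \<sigma>)) \<rho> in
     (x, y) \<in> J \<or> (x, a) \<in> J \<and> (b, y) \<in> J \<or> (x, b) \<in> J \<and> (a, y) \<in> J)"
  unfolding join_rel_def conn_block_rel_merge[OF assms] conn_insert_iff Let_def ..

text \<open>A merge lowers the number of blocks by one. The join loses a block too if
  \<open>a\<close> and \<open>b\<close> were not joined, which preserves the balance; otherwise the
  join stays and, by \<open>join_card_ge\<close>, the inequality becomes strict.\<close>

lemma induce_cycle_merge_iff:
  assumes part: "partition_on {1..n} (insert A (insert B \<sigma>))" and \<rho>: "partition_on {1..n} \<rho>"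
    and new: "A \<noteq> B" "A \<notin> \<sigma>" "B \<notin> \<sigma>" and ab: "a \<in> A" "b \<in> B"
  shows "induce_cycle n (insert (A \<union> B) \<sigma>) \<rho> \<longleftrightarrow>
    induce_cycle n (insert A (insert B \<sigma>)) \<rho> \<or> (a, b) \<in> join_rel (insert A (insert B \<sigma>)) \<rho>"
proof -
  let ?\<tau> = "insert A (insert B \<sigma>)" and ?\<tau>' = "insert (A \<union> B) \<sigma>"
  note merge = partition_on_merge[OF part new]
  have "finite ?\<tau>" using part by (rule finite_elements[rotated]) simp
  then have card: "card ?\<tau> = Suc (card ?\<tau>')" using new merge(2) by simp
  have "a \<in> {1..n}" "b \<in> {1..n}" using ab partition_onD1[OF part] by blast+
  then have "Suc (join_card n ?\<tau>' \<rho>) = join_card n ?\<tau> \<rho>" if "(a, b) \<notin> join_rel ?\<tau> \<rho>"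
    using card_classes_insert[of "{1..n}" a b "block_rel ?\<tau> \<union> block_rel \<rho>"] that
    unfolding join_card_def join_rel_def
      classes_cong[OF conn_block_rel_merge[OF ab, of \<sigma> "block_rel \<rho>"]]
    by simp
  moreover have "join_card n ?\<tau>' \<rho> = join_card n ?\<tau> \<rho>" if "(a, b) \<in> join_rel ?\<tau> \<rho>"
    using classes_cong[OF conn_insert_same[of a b "block_rel ?\<tau> \<union> block_rel \<rho>"]] that
    unfolding join_card_def join_rel_def
      classes_cong[OF conn_block_rel_merge[OF ab, of \<sigma> "block_rel \<rho>"]]
    by simp
  ultimately show ?thesis
    using card join_card_ge[OF part \<rho>] induce_cycle_iff[OF part \<rho>] induce_cycle_iff[OF merge(1) \<rho>]
    by (cases "(a, b) \<in> join_rel ?\<tau> \<rho>") auto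
qed

lemma induce_cycle_merge3_iff:
  assumes part: "partition_on {1..n} (insert A (insert B (insert C \<sigma>)))"
    and \<rho>: "partition_on {1..n} \<rho>"
    and new: "distinct [A, B, C]" "A \<notin> \<sigma>" "B \<notin> \<sigma>" "C \<notin> \<sigma>"
    and abc: "a \<in> A" "b \<in> B" "c \<in> C"
  defines "J \<equiv> join_rel (insert A (insert B (insert C \<sigma>))) \<rho>"
  shows "induce_cycle n (insert (A \<union> B \<union> C) \<sigma>) \<rho> \<longleftrightarrow>
    induce_cycle n (insert A (insert B (insert C \<sigma>))) \<rho> \<or> (a, b) \<in> J \<or> (a, c) \<in> J \<or> (b, c) \<in> J"
proof -
  have AB: "A \<noteq> B" "A \<notin> insert C \<sigma>" "B \<notin> insert C \<sigma>" using new by auto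
  note merge = partition_on_merge[OF part AB]
  have AB': "A \<union> B \<noteq> C" "A \<union> B \<notin> \<sigma>" using merge(2) by auto
  have "(a, a) \<in> J" by (simp add: J_def join_rel_def)
  then have "(a, c) \<in> join_rel (insert (A \<union> B) (insert C \<sigma>)) \<rho> \<longleftrightarrow> (a, c) \<in> J \<or> (b, c) \<in> J \<or> (a, b) \<in> J \<and> (a, c) \<in> J"
    unfolding join_rel_merge_iff[OF abc(1,2)] J_def Let_def by blast
  then show ?thesis
    using induce_cycle_merge_iff[OF merge(1) \<rho> AB' new(4), of a c]
      induce_cycle_merge_iff[OF part \<rho> AB abc(1,2)] abc
    unfolding J_def by blast
qed

text \<open>The last two disjuncts arise because, once \<open>A\<close> and \<open>B\<close> are
  merged, \<open>c\<close> and \<open>d\<close> may also be joined by way of \<open>a\<close> and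
  \<open>b\<close>.\<close>

lemma induce_cycle_merge22_iff:
  assumes part: "partition_on {1..n} (insert A (insert B (insert C (insert D \<sigma>))))"
    and \<rho>: "partition_on {1..n} \<rho>"
    and new: "distinct [A, B, C, D]" "A \<notin> \<sigma>" "B \<notin> \<sigma>" "C \<notin> \<sigma>" "D \<notin> \<sigma>"
    and abcd: "a \<in> A" "b \<in> B" "c \<in> C" "d \<in> D"
  defines "J \<equiv> join_rel (insert A (insert B (insert C (insert D \<sigma>)))) \<rho>"
  shows "induce_cycle n (insert (A \<union> B) (insert (C \<union> D) \<sigma>)) \<rho> \<longleftrightarrow>
    induce_cycle n (insert A (insert B (insert C (insert D \<sigma>)))) \<rho> \<or> (a, b) \<in> J \<or> (c, d) \<in> J \<or>
    (a, c) \<in> J \<and> (b, d) \<in> J \<or> (a, d) \<in> J \<and> (b, c) \<in> J"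
proof -
  have AB: "A \<noteq> B" "A \<notin> insert C (insert D \<sigma>)" "B \<notin> insert C (insert D \<sigma>)" using new by auto
  note merge = partition_on_merge[OF part AB]
  have part': "partition_on {1..n} (insert C (insert D (insert (A \<union> B) \<sigma>)))"
    using merge(1) by (simp add: insert_commute)
  have CD: "C \<noteq> D" "C \<notin> insert (A \<union> B) \<sigma>" "D \<notin> insert (A \<union> B) \<sigma>"
    using merge(2) new by auto
  have sym: "(x, y) \<in> J \<longleftrightarrow> (y, x) \<in> J" for x y
    unfolding J_def join_rel_def by (rule conn_sym_iff)
  have "(c, d) \<in> join_rel (insert (A \<union> B) (insert C (insert D \<sigma>))) \<rho> \<longleftrightarrow>
      (c, d) \<in> J \<or> (a, c) \<in> J \<and> (b, d) \<in> J \<or> (a, d) \<in> J \<and> (b, c) \<in> J"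
    unfolding join_rel_merge_iff[OF abcd(1,2)] J_def[symmetric] Let_def using sym[of a c] sym[of b c] by blast
  moreover have "insert C (insert D (insert (A \<union> B) \<sigma>)) = insert (A \<union> B) (insert C (insert D \<sigma>))"
      "insert (C \<union> D) (insert (A \<union> B) \<sigma>) = insert (A \<union> B) (insert (C \<union> D) \<sigma>)"
    by blast+
  ultimately show ?thesis
    using induce_cycle_merge_iff[OF part' \<rho> CD abcd(3,4)] induce_cycle_merge_iff[OF part \<rho> AB abcd(1,2)]
    unfolding J_def by simp
qed

lemma induce_cycle_merge4_iff:
  assumes part: "partition_on {1..n} (insert A (insert B (insert C (insert D \<sigma>))))"
    and \<rho>: "partition_on {1..n} \<rho>"
    and new: "distinct [A, B, C, D]" "A \<notin> \<sigma>" "B \<notin> \<sigma>" "C \<notin> \<sigma>" "D \<notin> \<sigma>"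
    and abcd: "a \<in> A" "b \<in> B" "c \<in> C" "d \<in> D"
  defines "J \<equiv> join_rel (insert A (insert B (insert C (insert D \<sigma>)))) \<rho>"
  shows "induce_cycle n (insert (A \<union> B \<union> C \<union> D) \<sigma>) \<rho> \<longleftrightarrow>
    induce_cycle n (insert A (insert B (insert C (insert D \<sigma>)))) \<rho> \<or> (a, b) \<in> J \<or> (a, c) \<in> J \<or>
    (a, d) \<in> J \<or> (b, c) \<in> J \<or> (b, d) \<in> J \<or> (c, d) \<in> J"
proof -
  have AB: "A \<noteq> B" "A \<notin> insert C (insert D \<sigma>)" "B \<notin> insert C (insert D \<sigma>)" using new by auto
  note merge = partition_on_merge[OF part AB]
  have ABCD: "distinct [A \<union> B, C, D]" "A \<union> B \<notin> \<sigma>" using merge(2) new by auto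
  define K where "K = join_rel (insert (A \<union> B) (insert C (insert D \<sigma>))) \<rho>"
  have K: "(x, y) \<in> K \<longleftrightarrow> (x, y) \<in> J \<or> (x, a) \<in> J \<and> (b, y) \<in> J \<or> (x, b) \<in> J \<and> (a, y) \<in> J" for x y
    unfolding K_def join_rel_merge_iff[OF abcd(1,2)] J_def Let_def ..
  have J: "(x, y) \<in> J \<longleftrightarrow> J `` {x} = J `` {y}" for x y
    unfolding J_def by (rule join_rel_class_iff)
  have "(a, b) \<in> J \<or> (a, c) \<in> K \<or> (a, d) \<in> K \<or> (c, d) \<in> K \<longleftrightarrow>
      (a, b) \<in> J \<or> (a, c) \<in> J \<or> (a, d) \<in> J \<or> (b, c) \<in> J \<or> (b, d) \<in> J \<or> (c, d) \<in> J"
    unfolding K J by metis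
  moreover have "a \<in> A \<union> B" using abcd by simp
  ultimately show ?thesis
    using induce_cycle_merge3_iff[OF merge(1) \<rho> ABCD new(4,5) _ abcd(3,4), of a]
      induce_cycle_merge_iff[OF part \<rho> AB abcd(1,2)]
    unfolding J_def K_def by blast
qed

text \<open>All entries depend only on whether the unmerged partition induces a cycle and on which
  of \<open>a\<close>, \<open>b\<close>, \<open>c\<close>, \<open>d\<close> are joined by it and
  \<open>\<rho>\<close>. They all vanish if it does or if more than one pair is joined. With no pair
  joined the identity reads 1 = 4 - 3; with only \<open>a\<close>, \<open>b\<close> or only
  \<open>c\<close>, \<open>d\<close> joined 0 = 2 - 2; with any other single pair 1 = 2 - 1.\<close>

lemma forest_matrix_four_blocks:
  assumes part: "partition_on {1..n} (insert A (insert B (insert C (insert D \<sigma>))))"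
    and \<rho>: "partition_on {1..n} \<rho>"
    and new: "distinct [A, B, C, D]" "A \<notin> \<sigma>" "B \<notin> \<sigma>" "C \<notin> \<sigma>" "D \<notin> \<sigma>"
  shows "forest_matrix n (insert (A \<union> B) (insert (C \<union> D) \<sigma>)) \<rho> =
    forest_matrix n (insert (A \<union> B \<union> C) (insert D \<sigma>)) \<rho> +
    forest_matrix n (insert (A \<union> B \<union> D) (insert C \<sigma>)) \<rho> +
    forest_matrix n (insert (A \<union> C \<union> D) (insert B \<sigma>)) \<rho> +
    forest_matrix n (insert (B \<union> C \<union> D) (insert A \<sigma>)) \<rho> -
    forest_matrix n (insert (A \<union> C) (insert (B \<union> D) \<sigma>)) \<rho> -
    forest_matrix n (insert (A \<union> D) (insert (B \<union> C) \<sigma>)) \<rho> -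
    forest_matrix n (insert (A \<union> B \<union> C \<union> D) \<sigma>) \<rho>"
proof -
  have "A \<noteq> {}" "B \<noteq> {}" "C \<noteq> {}" "D \<noteq> {}" using partition_onD3[OF part] by auto
  then obtain a b c d where abcd: "a \<in> A" "b \<in> B" "c \<in> C" "d \<in> D" by blast
  define \<tau> where "\<tau> = insert A (insert B (insert C (insert D \<sigma>)))"
  define k where "k x = join_rel \<tau> \<rho> `` {x}" for x
  have k: "(x, y) \<in> join_rel \<tau> \<rho> \<longleftrightarrow> k x = k y" for x y
    unfolding k_def by (rule join_rel_class_iff)
  \<comment> \<open>Reorderings of the same partition, so that the merge lemmas yield every grouping
    of the four blocks.\<close>
  have perm: "\<tau> = insert A (insert B (insert D (insert C \<sigma>)))"
    "\<tau> = insert A (insert C (insert D (insert B \<sigma>)))"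
    "\<tau> = insert B (insert C (insert D (insert A \<sigma>)))"
    "\<tau> = insert A (insert C (insert B (insert D \<sigma>)))"
    "\<tau> = insert A (insert D (insert B (insert C \<sigma>)))"
    by (auto simp: \<tau>_def)
  have p: "partition_on {1..n} \<tau>" using part by (simp add: \<tau>_def)
  have dist: "distinct [A, B, D, C]" "distinct [A, C, D, B]" "distinct [B, C, D, A]"
    "distinct [A, C, B, D]" "distinct [A, D, B, C]"
    "distinct [A, B, C]" "distinct [A, B, D]" "distinct [A, C, D]" "distinct [B, C, D]"
    using new(1) by auto
  have out: "A \<notin> insert D \<sigma>" "B \<notin> insert D \<sigma>" "C \<notin> insert D \<sigma>"
    "A \<notin> insert C \<sigma>" "B \<notin> insert C \<sigma>" "D \<notin> insert C \<sigma>"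
    "A \<notin> insert B \<sigma>" "C \<notin> insert B \<sigma>" "D \<notin> insert B \<sigma>"
    "B \<notin> insert A \<sigma>" "C \<notin> insert A \<sigma>" "D \<notin> insert A \<sigma>"
    using new by auto
  let ?I = "\<lambda>\<tau>. induce_cycle n \<tau> \<rho>"
  have I1: "?I (insert (A \<union> B) (insert (C \<union> D) \<sigma>)) \<longleftrightarrow>
      ?I \<tau> \<or> k a = k b \<or> k c = k d \<or> k a = k c \<and> k b = k d \<or> k a = k d \<and> k b = k c"
    using induce_cycle_merge22_iff[OF p[unfolded \<tau>_def] \<rho> new abcd]
    unfolding \<tau>_def[symmetric] k .
  have I2: "?I (insert (A \<union> C) (insert (B \<union> D) \<sigma>)) \<longleftrightarrow>
      ?I \<tau> \<or> k a = k c \<or> k b = k d \<or> k a = k b \<and> k c = k d \<or> k a = k d \<and> k c = k b"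
    using induce_cycle_merge22_iff[OF p[unfolded perm(4)] \<rho> dist(4) new(2,4,3,5) abcd(1,3,2,4)]
    unfolding perm(4)[symmetric] k .
  have I3: "?I (insert (A \<union> D) (insert (B \<union> C) \<sigma>)) \<longleftrightarrow>
      ?I \<tau> \<or> k a = k d \<or> k b = k c \<or> k a = k b \<and> k d = k c \<or> k a = k c \<and> k d = k b"
    using induce_cycle_merge22_iff[OF p[unfolded perm(5)] \<rho> dist(5) new(2,5,3,4) abcd(1,4,2,3)]
    unfolding perm(5)[symmetric] k .
  have I4: "?I (insert (A \<union> B \<union> C) (insert D \<sigma>)) \<longleftrightarrow> ?I \<tau> \<or> k a = k b \<or> k a = k c \<or> k b = k c"
    using induce_cycle_merge3_iff[OF p[unfolded \<tau>_def] \<rho> dist(6) out(1-3) abcd(1,2,3)]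
    unfolding \<tau>_def[symmetric] k .
  have I5: "?I (insert (A \<union> B \<union> D) (insert C \<sigma>)) \<longleftrightarrow> ?I \<tau> \<or> k a = k b \<or> k a = k d \<or> k b = k d"
    using induce_cycle_merge3_iff[OF p[unfolded perm(1)] \<rho> dist(7) out(4-6) abcd(1,2,4)]
    unfolding perm(1)[symmetric] k .
  have I6: "?I (insert (A \<union> C \<union> D) (insert B \<sigma>)) \<longleftrightarrow> ?I \<tau> \<or> k a = k c \<or> k a = k d \<or> k c = k d"
    using induce_cycle_merge3_iff[OF p[unfolded perm(2)] \<rho> dist(8) out(7-9) abcd(1,3,4)]
    unfolding perm(2)[symmetric] k .
  have I7: "?I (insert (B \<union> C \<union> D) (insert A \<sigma>)) \<longleftrightarrow> ?I \<tau> \<or> k b = k c \<or> k b = k d \<or> k c = k d"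
    using induce_cycle_merge3_iff[OF p[unfolded perm(3)] \<rho> dist(9) out(10-12) abcd(2,3,4)]
    unfolding perm(3)[symmetric] k .
  have I8: "?I (insert (A \<union> B \<union> C \<union> D) \<sigma>) \<longleftrightarrow> ?I \<tau> \<or> k a = k b \<or> k a = k c \<or>
      k a = k d \<or> k b = k c \<or> k b = k d \<or> k c = k d"
    using induce_cycle_merge4_iff[OF p[unfolded \<tau>_def] \<rho> new abcd]
    unfolding \<tau>_def[symmetric] k .
  show ?thesis
    unfolding forest_matrix_def I1 I2 I3 I4 I5 I6 I7 I8
    by (cases "?I \<tau>"; cases "k a = k b"; cases "k a = k c"; cases "k a = k d"; cases "k b = k c";
        cases "k b = k d"; cases "k c = k d") simp_all
qed

section \<open>Non-crossing partitions\<close>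

text \<open>From here on, an ordering is given by the function \<open>p\<close> that maps an element to its position.\<close>

definition cross :: "('a \<Rightarrow> nat) \<Rightarrow> 'a set \<Rightarrow> 'a set \<Rightarrow> bool" where
  "cross p A B \<longleftrightarrow> (\<exists>a1\<in>A. \<exists>a2\<in>A. \<exists>b1\<in>B. \<exists>b2\<in>B.
     p a1 < p b1 \<and> p b1 < p a2 \<and> p a2 < p b2 \<or> p b1 < p a1 \<and> p a1 < p b2 \<and> p b2 < p a2)"

definition ncross :: "('a \<Rightarrow> nat) \<Rightarrow> 'a set set \<Rightarrow> bool" where
  "ncross p \<pi> \<longleftrightarrow> (\<forall>A\<in>\<pi>. \<forall>B\<in>\<pi>. A \<noteq> B \<longrightarrow> \<not> cross p A B)"

lemma cross_commute: "cross p A B \<longleftrightarrow> cross p B A"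
  unfolding cross_def by blast

lemma cross_mono: "cross p A B \<Longrightarrow> A \<subseteq> A' \<Longrightarrow> B \<subseteq> B' \<Longrightarrow> cross p A' B'"
  unfolding cross_def by blast

text \<open>Both alternatives in one: an interval spanned by \<open>B\<close> separates two elements
  of \<open>A\<close>. This form suits the case where \<open>A\<close> is a union.\<close>

lemma cross_iff_between:
  "cross p A B \<longleftrightarrow> (\<exists>a\<in>A. \<exists>a'\<in>A. \<exists>b1\<in>B. \<exists>b2\<in>B.
     p b1 < p a \<and> p a < p b2 \<and> (p a' < p b1 \<or> p b2 < p a'))"
  unfolding cross_def by blast

lemma not_cross_singleton: "\<not> cross p {x} B" "\<not> cross p B {x}"
  unfolding cross_def by auto

text \<open>A crossing involves only comparisons between the two sets, so \<open>g\<close> may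
  reorder or identify elements within each of them.\<close>

lemma cross_transfer:
  assumes "cross p A B"
    and "\<And>x y. x \<in> A \<Longrightarrow> y \<in> B \<Longrightarrow> p x < p y \<Longrightarrow> q (g x) < q (g y)"
    and "\<And>x y. x \<in> A \<Longrightarrow> y \<in> B \<Longrightarrow> p y < p x \<Longrightarrow> q (g y) < q (g x)"
    and "g ` A \<subseteq> A'" "g ` B \<subseteq> B'"
  shows "cross q A' B'"
proof -
  obtain a1 a2 b1 b2 where "a1 \<in> A" "a2 \<in> A" "b1 \<in> B" "b2 \<in> B"
    "p a1 < p b1 \<and> p b1 < p a2 \<and> p a2 < p b2 \<or> p b1 < p a1 \<and> p a1 < p b2 \<and> p b2 < p a2"
    using assms(1) unfolding cross_def by blast
  then have "g a1 \<in> A'" "g a2 \<in> A'" "g b1 \<in> B'" "g b2 \<in> B'"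
    "q (g a1) < q (g b1) \<and> q (g b1) < q (g a2) \<and> q (g a2) < q (g b2) \<or>
     q (g b1) < q (g a1) \<and> q (g a1) < q (g b2) \<and> q (g b2) < q (g a2)"
    using assms(2-5) by blast+
  then show ?thesis unfolding cross_def by blast
qed

text \<open>No element of \<open>S\<close> separates \<open>i\<close> from \<open>j\<close>, so an
  interval spanned by \<open>S\<close> contains both or neither. As it splits neither
  \<open>P\<close> nor \<open>Q\<close>, it does not split their union.\<close>

lemma not_cross_Un:
  assumes "i \<in> P" "j \<in> Q" "\<not> cross p P S" "\<not> cross p Q S"
    and "\<And>b. b \<in> S \<Longrightarrow> p b < p i \<and> p b < p j \<or> p i < p b \<and> p j < p b"
  shows "\<not> cross p (P \<union> Q) S"
proof
  assume "cross p (P \<union> Q) S"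
  then obtain a a' b1 b2 where ab: "a \<in> P \<union> Q" "a' \<in> P \<union> Q" "b1 \<in> S" "b2 \<in> S"
    "p b1 < p a" "p a < p b2" "p a' < p b1 \<or> p b2 < p a'"
    unfolding cross_iff_between by blast
  have P: False if "x \<in> P" "x' \<in> P" "p b1 < p x" "p x < p b2" "p x' < p b1 \<or> p b2 < p x'" for x x'
    using assms(3) that ab(3,4) unfolding cross_iff_between by blast
  have Q: False if "x \<in> Q" "x' \<in> Q" "p b1 < p x" "p x < p b2" "p x' < p b1 \<or> p b2 < p x'" for x x'
    using assms(4) that ab(3,4) unfolding cross_iff_between by blast
  have "p b1 < p i \<and> p i < p b2 \<and> p b1 < p j \<and> p j < p b2 \<or>
      (p i < p b1 \<or> p b2 < p i) \<and> (p j < p b1 \<or> p b2 < p j)"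
    using assms(5)[OF ab(3)] assms(5)[OF ab(4)] ab(5,6) by linarith
  then show False
    using P[of a a'] P[of a i] P[of i a'] Q[of a a'] Q[of a j] Q[of j a'] assms(1,2) ab by blast
qed

lemma ncross_insert:
  assumes "ncross p \<sigma>" "\<And>S. S \<in> \<sigma> \<Longrightarrow> \<not> cross p U S"
  shows "ncross p (insert U \<sigma>)"
  unfolding ncross_def
proof (intro ballI impI)
  fix A B assume "A \<in> insert U \<sigma>" "B \<in> insert U \<sigma>" "A \<noteq> B"
  then consider "A \<in> \<sigma>" "B \<in> \<sigma>" "A \<noteq> B" | "A = U" "B \<in> \<sigma>" | "A \<in> \<sigma>" "B = U" by blast
  then show "\<not> cross p A B"
  proof cases
    case 1
    then show ?thesis using assms(1) unfolding ncross_def by blast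
  next
    case 2
    then show ?thesis using assms(2) by simp
  next
    case 3
    then show ?thesis using assms(2) cross_commute[of p A B] by simp
  qed
qed

section \<open>Rows of the matrix as vectors\<close>

interpretation fun_scale: vector_space "fun_scale :: real \<Rightarrow> ('a \<Rightarrow> real) \<Rightarrow> 'a \<Rightarrow> real"
  by (rule vector_space_fun_scale)

lemma forest_matrix_row_four_blocks:
  assumes part: "partition_on {1..n} (insert A (insert B (insert C (insert D \<sigma>))))"
    and new: "distinct [A, B, C, D]" "A \<notin> \<sigma>" "B \<notin> \<sigma>" "C \<notin> \<sigma>" "D \<notin> \<sigma>"
  shows "forest_matrix_row n (insert (A \<union> B) (insert (C \<union> D) \<sigma>)) =
    forest_matrix_row n (insert (A \<union> B \<union> C) (insert D \<sigma>)) +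
    forest_matrix_row n (insert (A \<union> B \<union> D) (insert C \<sigma>)) +
    forest_matrix_row n (insert (A \<union> C \<union> D) (insert B \<sigma>)) +
    forest_matrix_row n (insert (B \<union> C \<union> D) (insert A \<sigma>)) -
    forest_matrix_row n (insert (A \<union> C) (insert (B \<union> D) \<sigma>)) -
    forest_matrix_row n (insert (A \<union> D) (insert (B \<union> C) \<sigma>)) -
    forest_matrix_row n (insert (A \<union> B \<union> C \<union> D) \<sigma>)"
  using forest_matrix_four_blocks[OF part _ new]
  by (auto simp: fun_eq_iff forest_matrix_row_def partitions_def)

definition ncross_partitions :: "nat \<Rightarrow> (nat \<Rightarrow> nat) \<Rightarrow> nat set set set" where
  "ncross_partitions n p = {\<pi> \<in> partitions n. ncross p \<pi>}"

section \<open>Exchanging two adjacent elements of the ordering\<close>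

lemma partition_on_split:
  assumes "partition_on X (insert (A \<union> B) \<sigma>)" "A \<union> B \<notin> \<sigma>" "A \<inter> B = {}" "A \<noteq> {}" "B \<noteq> {}"
  shows "partition_on X (insert A (insert B \<sigma>))" "A \<notin> \<sigma>" "B \<notin> \<sigma>"
proof -
  have d: "(A \<union> B) \<inter> S = {}" if "S \<in> \<sigma>" for S
    using assms(1,2) that by (auto simp: partition_on_def disjoint_def)
  then show new: "A \<notin> \<sigma>" "B \<notin> \<sigma>" using assms(4,5) by blast+
  have X: "X = A \<union> B \<union> \<Union>\<sigma>" "disjoint \<sigma>" "{} \<notin> \<sigma>"
    using assms(1) by (auto simp: partition_on_def disjoint_def)
  have "disjoint (insert A (insert B \<sigma>))"
    using d assms(3) X(2) unfolding disjoint_def by (auto simp: Int_commute)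
  then show "partition_on X (insert A (insert B \<sigma>))"
    using X(1,3) assms(4,5) by (auto simp: partition_on_def)
qed

text \<open>Brings a partition into the four-block form of
  \<open>forest_matrix_row_four_blocks\<close>, with the two elements to be exchanged cut off from
  their blocks.\<close>

lemma partition_on_split_pairs:
  assumes "partition_on X \<pi>" "P \<in> \<pi>" "Q \<in> \<pi>" "P \<noteq> Q" "i \<in> P" "j \<in> Q" "P \<noteq> {i}" "Q \<noteq> {j}"
  shows "partition_on X (insert {i} (insert (P - {i}) (insert {j} (insert (Q - {j}) (\<pi> - {P, Q})))))"
    and "distinct [{i}, P - {i}, {j}, Q - {j}]"
    and "{i} \<notin> \<pi> - {P, Q}" "P - {i} \<notin> \<pi> - {P, Q}" "{j} \<notin> \<pi> - {P, Q}" "Q - {j} \<notin> \<pi> - {P, Q}"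
proof -
  define \<sigma> where "\<sigma> = \<pi> - {P, Q}"
  have \<sigma>: "P \<notin> insert Q \<sigma>" "Q \<notin> \<sigma>" "insert P (insert Q \<sigma>) = \<pi>"
    using assms(2-4) by (auto simp: \<sigma>_def)
  have ne: "P - {i} \<noteq> {}" "Q - {j} \<noteq> {}" using assms(5-8) by auto
  have P: "{i} \<union> (P - {i}) = P" and Q: "{j} \<union> (Q - {j}) = Q" using assms(5,6) by auto
  have disj: "{x} \<inter> (S - {x}) = {}" "{x} \<noteq> {}" for x and S :: "'a set" by auto
  have "partition_on X (insert P (insert Q \<sigma>))" using assms(1) \<sigma>(3) by simp
  note i = partition_on_split[of X "{i}" "P - {i}", unfolded P, OF this \<sigma>(1) disj ne(1)]
  have part: "partition_on X (insert Q (insert {i} (insert (P - {i}) \<sigma>)))"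
    using i(1) by (simp only: insert_commute)
  have "Q \<notin> insert {i} (insert (P - {i}) \<sigma>)" using i(2,3) \<sigma>(2) by auto
  note j = partition_on_split[of X "{j}" "Q - {j}", unfolded Q, OF part this disj ne(2)]
  show "partition_on X (insert {i} (insert (P - {i}) (insert {j} (insert (Q - {j}) (\<pi> - {P, Q})))))"
    using j(1) unfolding \<sigma>_def[symmetric] by (simp only: insert_commute)
  have "{i} \<noteq> P - {i}" "{j} \<noteq> Q - {j}" by auto
  moreover have "{i} \<noteq> {j}" "{i} \<noteq> Q - {j}" "P - {i} \<noteq> {j}" "P - {i} \<noteq> Q - {j}" using j(2,3) by (metis insertI1 insertI2)+
  ultimately show "distinct [{i}, P - {i}, {j}, Q - {j}]"
    by (simp only: distinct.simps list.set insert_iff empty_iff simp_thms)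
  show "{i} \<notin> \<pi> - {P, Q}" "P - {i} \<notin> \<pi> - {P, Q}" "{j} \<notin> \<pi> - {P, Q}" "Q - {j} \<notin> \<pi> - {P, Q}"
    using i(2,3) j(2,3) unfolding \<sigma>_def[symmetric] by simp_all
qed

lemma distinct4_permute:
  assumes "distinct [a, b, c, d]"
  shows "distinct [a, b, d, c] \<and> distinct [a, c, d, b] \<and> distinct [b, c, d, a] \<and>
    distinct [a, c, b, d] \<and> distinct [a, d, b, c]"
  using assms by auto

text \<open>Only the comparison of \<open>i\<close> with \<open>j\<close> differs between the two
  orderings, so under \<open>p\<close> only the blocks of \<open>i\<close> and \<open>j\<close> can
  cross. The four-block relation then replaces \<open>\<pi>\<close> by seven partitions that are
  non-crossing for \<open>p\<close>.\<close>

lemma row_in_span_adjacent_swap: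
  assumes p: "inj_on p {1..n}" and ij: "i \<in> {1..n}" "j \<in> {1..n}" "p j = Suc (p i)"
    and \<pi>: "partition_on {1..n} \<pi>" "ncross (transpose (p i) (p j) \<circ> p) \<pi>"
  shows "forest_matrix_row n \<pi> \<in> fun_span (forest_matrix_row n ` ncross_partitions n p)"
proof -
  let ?span = "fun_span (forest_matrix_row n ` ncross_partitions n p)"
  define q where "q = transpose (p i) (p j) \<circ> p"
  note \<pi> = \<pi>[folded q_def]
  have in_span: "forest_matrix_row n \<tau> \<in> ?span" if "partition_on {1..n} \<tau>" "ncross p \<tau>" for \<tau>
    using that unfolding fun_span_def
    by (intro fun_scale.span_base) (auto simp: ncross_partitions_def partitions_def)
  have q: "q i = Suc (p i)" "q j = p i" using ij by (auto simp: q_def transpose_def)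
  have qx: "q x = p x" "p x < p i \<or> Suc (p i) < p x" if "x \<in> {1..n}" "x \<noteq> i" "x \<noteq> j" for x
  proof -
    have "p x \<noteq> p i" "p x \<noteq> p j" using that ij(1,2) inj_onD[OF p] by blast+
    then show "q x = p x" "p x < p i \<or> Suc (p i) < p x" using ij(3) by (auto simp: q_def)
  qed
  have sub: "A \<subseteq> {1..n}" if "A \<in> \<pi>" for A using partition_onD1[OF \<pi>(1)] that by blast
  \<comment> \<open>The elements unaffected by the exchange: they keep their position and lie on the
    same side of \<open>i\<close> and \<open>j\<close>.\<close>
  define R where "R x \<longleftrightarrow> x \<noteq> i \<and> x \<noteq> j \<and> q x = p x \<and> (p x < p i \<or> Suc (p i) < p x)" for x
  have R: "x = i \<or> x = j \<or> R x" if "x \<in> {1..n}" for x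
    using qx[OF that] unfolding R_def by blast
  have mono: "q x < q y" if "x \<in> {1..n}" "y \<in> {1..n}" "p x < p y" "\<not> (x = i \<and> y = j)" for x y
    using R[OF that(1)] R[OF that(2)] that(3,4) q ij(3) unfolding R_def by auto
  have same: "\<not> cross p A B" if "A \<in> \<pi>" "B \<in> \<pi>" "A \<noteq> B"
      "\<not> (i \<in> A \<and> j \<in> B)" "\<not> (i \<in> B \<and> j \<in> A)" for A B
  proof
    assume "cross p A B"
    then have "cross q A B"
    proof (rule cross_transfer[where g = id])
      fix x y assume xy: "x \<in> A" "y \<in> B"
      then have "x \<in> {1..n}" "y \<in> {1..n}" using sub that(1,2) by blast+
      then show "p x < p y \<Longrightarrow> q (id x) < q (id y)" "p y < p x \<Longrightarrow> q (id y) < q (id x)"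
        using mono[of x y] mono[of y x] xy that(4,5) by auto
    qed auto
    then show False using that \<pi>(2) by (auto simp: ncross_def)
  qed
  obtain P Q where PQ: "P \<in> \<pi>" "i \<in> P" "Q \<in> \<pi>" "j \<in> Q"
    using ij(1,2) partition_onD1[OF \<pi>(1)] by blast
  have uniq: "A = P" if "A \<in> \<pi>" "i \<in> A" for A
    using that PQ \<pi>(1) by (auto simp: partition_on_def disjoint_def)
  have uniq': "A = Q" if "A \<in> \<pi>" "j \<in> A" for A
    using that PQ \<pi>(1) by (auto simp: partition_on_def disjoint_def)
  show ?thesis
  proof (cases "P = Q \<or> P = {i} \<or> Q = {j}")
    \<comment> \<open>Here \<open>\<pi>\<close> itself is non-crossing for \<open>p\<close>: either
      no two different blocks separate \<open>i\<close> from \<open>j\<close>, or one of the two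
      blocks is a singleton.\<close>
    case True
    have "\<not> cross p A B" if AB: "A \<in> \<pi>" "B \<in> \<pi>" "A \<noteq> B" for A B
      using same[OF AB] True AB uniq uniq' not_cross_singleton by metis
    then show ?thesis using in_span \<pi>(1) by (auto simp: ncross_def)
  next
    case False
    then have "P \<noteq> Q" "P \<noteq> {i}" "Q \<noteq> {j}" by auto
    note split = partition_on_split_pairs[OF \<pi>(1) PQ(1,3) this(1) PQ(2,4) this(2,3)]
    define \<sigma> where "\<sigma> = \<pi> - {P, Q}"
    note split = split[folded \<sigma>_def]
    have i: "i \<notin> Q" "j \<notin> P" using \<open>P \<noteq> Q\<close> uniq[of Q] uniq'[of P] PQ(1,3) by blast+
    then have "i \<noteq> j" using PQ by blast
    note i = i this
    have \<sigma>: "S \<in> \<pi>" "S \<noteq> P" "S \<noteq> Q" "i \<notin> S" "j \<notin> S" "S \<subseteq> {1..n}" if "S \<in> \<sigma>" for S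
      using that uniq[of S] uniq'[of S] sub[of S] unfolding \<sigma>_def by blast+
    have "ncross p \<sigma>"
      unfolding ncross_def
    proof (intro ballI impI)
      fix S T assume ST: "S \<in> \<sigma>" "T \<in> \<sigma>" "S \<noteq> T"
      show "\<not> cross p S T"
        by (rule same) (use ST \<sigma>[OF ST(1)] \<sigma>[OF ST(2)] in simp_all)
    qed
    have PQS: "\<not> cross p (P \<union> Q) S" if "S \<in> \<sigma>" for S
    proof (rule not_cross_Un[OF PQ(2,4)])
      show "\<not> cross p P S" "\<not> cross p Q S"
        using same[of P S] same[of Q S] \<sigma>[OF that] PQ(1,3) by blast+
      show "p b < p i \<and> p b < p j \<or> p i < p b \<and> p j < p b" if "b \<in> S" for b
      proof -
        have "b \<in> {1..n}" "b \<noteq> i" "b \<noteq> j" using \<sigma>(4-6)[OF \<open>S \<in> \<sigma>\<close>] that by blast+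
        then show ?thesis using qx(2)[of b] ij(3) by linarith
      qed
    qed
    have qPQ: "\<not> cross q P Q" using \<pi>(2) PQ \<open>P \<noteq> Q\<close> by (simp add: ncross_def)
    \<comment> \<open>Parts of \<open>P\<close> and \<open>Q\<close> inherit from \<open>PQS\<close>
      that they cross no other block, so only their mutual crossing has to be excluded.\<close>
    have pair: "forest_matrix_row n (insert U (insert W \<sigma>)) \<in> ?span"
      if "partition_on {1..n} (insert U (insert W \<sigma>))" "U \<subseteq> P \<union> Q" "W \<subseteq> P \<union> Q" "\<not> cross p U W" for U W
      using that(1)
    proof (rule in_span)
      have "\<not> cross p U S" "\<not> cross p W S" if "S \<in> \<sigma>" for S
        using PQS[OF that] cross_mono[OF _ \<open>U \<subseteq> P \<union> Q\<close> order_refl]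
          cross_mono[OF _ \<open>W \<subseteq> P \<union> Q\<close> order_refl] by blast+
      then show "ncross p (insert U (insert W \<sigma>))"
        using \<open>ncross p \<sigma>\<close> that(4) by (intro ncross_insert) auto
    qed
    let ?A = "{i}" and ?B = "P - {i}" and ?C = "{j}" and ?D = "Q - {j}"
    have AB: "?A \<union> ?B = P" and CD: "?C \<union> ?D = Q" using PQ by auto
    have B: "x \<in> {1..n}" "x \<noteq> i" "x \<noteq> j" "x \<in> P" if "x \<in> ?B" for x
      using that i sub[OF PQ(1)] by auto
    have D: "x \<in> {1..n}" "x \<noteq> i" "x \<noteq> j" "x \<in> Q" if "x \<in> ?D" for x
      using that i sub[OF PQ(3)] by auto
    have BD: "q x = p x" "p x < p i \<or> Suc (p i) < p x" if "x \<in> ?B \<union> ?D" for x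
      using that B[of x] D[of x] qx[of x] by blast+
    have other: "R x" if "x \<in> ?B \<union> ?D" for x
      using that B[of x] D[of x] BD[of x] unfolding R_def by blast
    have perm: "partition_on {1..n} (insert ?A (insert ?B (insert ?D (insert ?C \<sigma>))))"
      "partition_on {1..n} (insert ?A (insert ?C (insert ?D (insert ?B \<sigma>))))"
      "partition_on {1..n} (insert ?B (insert ?C (insert ?D (insert ?A \<sigma>))))"
      "partition_on {1..n} (insert ?A (insert ?C (insert ?B (insert ?D \<sigma>))))"
      "partition_on {1..n} (insert ?A (insert ?D (insert ?B (insert ?C \<sigma>))))"
      using split(1) by (simp_all only: insert_commute)
    have dist: "distinct [?A, ?B, ?D, ?C]" "distinct [?A, ?C, ?D, ?B]" "distinct [?B, ?C, ?D, ?A]"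
      "distinct [?A, ?C, ?B, ?D]" "distinct [?A, ?D, ?B, ?C]"
      using distinct4_permute[OF split(2)] by blast+
    have ABC: "forest_matrix_row n (insert (?A \<union> ?B \<union> ?C) (insert ?D \<sigma>)) \<in> ?span"
    proof (rule pair[OF partition_on_merge4(2)[OF split]])
      show "\<not> cross p (?A \<union> ?B \<union> ?C) ?D"
      proof
        \<comment> \<open>Identifying \<open>j\<close> with \<open>i\<close> maps the first set into
          \<open>P\<close>. Elements of \<open>?D\<close> do not distinguish \<open>i\<close> from
          \<open>j\<close>, so a crossing of \<open>P\<close> and \<open>Q\<close> for
          \<open>q\<close> results.\<close>
        let ?g = "\<lambda>x. if x = j then i else x"
        assume "cross p (?A \<union> ?B \<union> ?C) ?D"
        then have "cross q P Q"
        proof (rule cross_transfer[where g = ?g])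
          fix x y assume "x \<in> ?A \<union> ?B \<union> ?C" "y \<in> ?D"
          then have "x = i \<or> x = j \<or> R x" "R y" using other by blast+
          then show "p x < p y \<Longrightarrow> q (?g x) < q (?g y)" "p y < p x \<Longrightarrow> q (?g y) < q (?g x)"
            using q ij(3) i(3) unfolding R_def by auto
        qed (use PQ i in auto)
        then show False using qPQ by simp
      qed
    qed (use PQ in auto)
    have ABD: "forest_matrix_row n (insert (?A \<union> ?B \<union> ?D) (insert ?C \<sigma>)) \<in> ?span"
      using PQ by (intro pair[OF partition_on_merge4(2)[OF perm(1) dist(1) split(3,4,6,5)]])
        (auto simp: not_cross_singleton)
    have ACD: "forest_matrix_row n (insert (?A \<union> ?C \<union> ?D) (insert ?B \<sigma>)) \<in> ?span"
    proof (rule pair[OF partition_on_merge4(2)[OF perm(2) dist(2) split(3,5,6,4)]])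
      show "\<not> cross p (?A \<union> ?C \<union> ?D) ?B"
      proof
        \<comment> \<open>The mirror image: \<open>i\<close> is identified with \<open>j\<close>,
          which maps the first set into \<open>Q\<close>.\<close>
        let ?g = "\<lambda>x. if x = i then j else x"
        assume "cross p (?A \<union> ?C \<union> ?D) ?B"
        then have "cross q Q P"
        proof (rule cross_transfer[where g = ?g])
          fix x y assume "x \<in> ?A \<union> ?C \<union> ?D" "y \<in> ?B"
          then have "x = i \<or> x = j \<or> R x" "R y" using other by blast+
          then show "p x < p y \<Longrightarrow> q (?g x) < q (?g y)" "p y < p x \<Longrightarrow> q (?g y) < q (?g x)"
            using q ij(3) i(3) unfolding R_def by auto
        qed (use PQ i in auto)
        then show False using qPQ cross_commute by blast
      qed
    qed (use PQ in auto)
    have BCD: "forest_matrix_row n (insert (?B \<union> ?C \<union> ?D) (insert ?A \<sigma>)) \<in> ?span"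
      using PQ by (intro pair[OF partition_on_merge4(2)[OF perm(3) dist(3) split(4,5,6,3)]])
        (auto simp: not_cross_singleton)
    have AC: "forest_matrix_row n (insert (?A \<union> ?C) (insert (?B \<union> ?D) \<sigma>)) \<in> ?span"
    proof (rule pair[OF partition_on_merge4(1)[OF perm(4) dist(4) split(3,5,4,6)]])
      \<comment> \<open>The pair of \<open>i\<close> and \<open>j\<close> occupies consecutive
        positions, and nothing lies strictly between them.\<close>
      show "\<not> cross p (?A \<union> ?C) (?B \<union> ?D)"
        unfolding cross_commute[of p "?A \<union> ?C"] cross_iff_between
        using BD(2) ij(3) by fastforce
    qed (use PQ in auto)
    have AD: "forest_matrix_row n (insert (?A \<union> ?D) (insert (?B \<union> ?C) \<sigma>)) \<in> ?span"
    proof (rule pair[OF partition_on_merge4(1)[OF perm(5) dist(5) split(3,6,4,5)]])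
      show "\<not> cross p (?A \<union> ?D) (?B \<union> ?C)"
      proof
        \<comment> \<open>Exchanging \<open>i\<close> and \<open>j\<close> turns these two sets into
          \<open>Q\<close> and \<open>P\<close> and the positions under \<open>p\<close> into those
          under \<open>q\<close>.\<close>
        let ?g = "transpose i j"
        assume "cross p (?A \<union> ?D) (?B \<union> ?C)"
        then have "cross q Q P"
        proof (rule cross_transfer[where g = ?g])
          have g: "q (?g x) = p x" if "x \<in> ?A \<union> ?B \<union> ?C \<union> ?D" for x
          proof -
            have "x = i \<or> x = j \<or> R x" using that other by blast
            then show ?thesis using q ij(3) unfolding R_def by auto
          qed
          fix x y assume "x \<in> ?A \<union> ?D" "y \<in> ?B \<union> ?C"
          then have "q (?g x) = p x" "q (?g y) = p y" by (intro g; blast)+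
          then show "p x < p y \<Longrightarrow> q (?g x) < q (?g y)" "p y < p x \<Longrightarrow> q (?g y) < q (?g x)"
            by simp_all
        qed (use PQ i in \<open>auto simp: transpose_def\<close>)
        then show False using qPQ cross_commute by blast
      qed
    qed (use PQ in auto)
    have ABCD: "forest_matrix_row n (insert (?A \<union> ?B \<union> ?C \<union> ?D) \<sigma>) \<in> ?span"
    proof (rule in_span[OF partition_on_merge4(3)[OF split]])
      have "?A \<union> ?B \<union> ?C \<union> ?D = P \<union> Q" using PQ by auto
      then show "ncross p (insert (?A \<union> ?B \<union> ?C \<union> ?D) \<sigma>)"
        using ncross_insert[OF \<open>ncross p \<sigma>\<close> PQS] by simp
    qed
    have "\<pi> = insert (?A \<union> ?B) (insert (?C \<union> ?D) \<sigma>)" unfolding AB CD \<sigma>_def using PQ by auto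
    then show ?thesis
      using forest_matrix_row_four_blocks[OF split] ABC ABD ACD BCD AC AD ABCD
      unfolding fun_span_def by (simp only: fun_scale.span_add fun_scale.span_diff)
  qed
qed

section \<open>Passing between arbitrary orderings\<close>

text \<open>Adjacent transpositions generate all permutations of the positions.\<close>

lemma permutes_adjacent_induct [consumes 1, case_names id swap]:
  fixes n :: nat
  assumes "q permutes {..<n}" and id: "P id"
    and swap: "\<And>q k. q permutes {..<n} \<Longrightarrow> P q \<Longrightarrow> Suc k < n \<Longrightarrow> P (transpose k (Suc k) \<circ> q)"
  shows "P q"
proof -
  \<comment> \<open>Induction on the distance: a transposition over a longer distance is the
    conjugate of one shorter by one under an adjacent transposition. Since \<open>q\<close> changes
    along the way, it is generalised.\<close>
  have step: "P (transpose a (a + Suc d) \<circ> q)" if "q permutes {..<n}" "P q" "a + Suc d < n" for a d q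
    using that
  proof (induction d arbitrary: q)
    case 0
    then have "P (transpose a (Suc a) \<circ> q)" by (intro swap) auto
    then show ?case by (simp only: add_Suc_right add_0_right)
  next
    case (Suc d)
    let ?b = "a + Suc d"
    let ?t = "transpose ?b (Suc ?b)" and ?u = "transpose a ?b"
    have t: "?t permutes {..<n}" "?u permutes {..<n}"
      using Suc.prems(3) by (auto intro!: permutes_swap_id)
    have tq: "?t \<circ> q permutes {..<n}" using Suc.prems(1) t(1) by (rule permutes_compose)
    have "P (?t \<circ> q)" using Suc.prems by (intro swap) auto
    then have "P (?u \<circ> (?t \<circ> q))" by (rule Suc.IH[OF tq]) (use Suc.prems(3) in simp)
    then have "P (?t \<circ> (?u \<circ> (?t \<circ> q)))"
      by (rule swap[OF permutes_compose[OF tq t(2)]]) (use Suc.prems(3) in simp)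
    moreover have "?t \<circ> (?u \<circ> (?t \<circ> q)) = transpose a (a + Suc (Suc d)) \<circ> q"
      using transpose_comp_triple[of "Suc ?b" a ?b] by (simp add: transpose_commute o_assoc)
    ultimately show ?case by (simp only:)
  qed
  have "P (transpose a b \<circ> q)"
    if "a \<in> {..<n}" "b \<in> {..<n}" "a \<noteq> b" "P q" "q permutes {..<n}" for a b q
  proof (cases "a < b")
    case True
    then show ?thesis using step[OF that(5,4), of a "b - Suc a"] that by simp
  next
    case False
    then show ?thesis
      using step[OF that(5,4), of b "a - Suc b"] that by (simp add: transpose_commute)
  qed
  then show ?thesis by (rule permutes_induct[where P = P, OF assms(1) finite_lessThan id])
qed

text \<open>The position of an element is the number of its predecessors in
  \<open>X\<close>.\<close>

lemma rank_bij:
  assumes "finite X" and trans: "\<And>x y z. \<lbrakk>x \<in> X; y \<in> X; z \<in> X; L x y; L y z\<rbrakk> \<Longrightarrow> L x z"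
    and irrefl: "\<And>x. x \<in> X \<Longrightarrow> \<not> L x x"
    and total: "\<And>x y. x \<in> X \<Longrightarrow> y \<in> X \<Longrightarrow> x \<noteq> y \<Longrightarrow> L x y \<or> L y x"
  obtains p :: "'a \<Rightarrow> nat" where "bij_betw p X {..<card X}"
    "\<And>x y. x \<in> X \<Longrightarrow> y \<in> X \<Longrightarrow> p x < p y \<longleftrightarrow> L x y"
proof -
  define p where "p x = card {y \<in> X. L y x}" for x
  have less: "p x < p y" if "x \<in> X" "y \<in> X" "L x y" for x y
  proof -
    have "{z \<in> X. L z x} \<subset> {z \<in> X. L z y}" using that trans irrefl by blast
    then show ?thesis unfolding p_def using assms(1) by (intro psubset_card_mono) auto
  qed
  have iff: "p x < p y \<longleftrightarrow> L x y" if "x \<in> X" "y \<in> X" for x y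
    using less[of x y] less[of y x] total[of x y] that by fastforce
  have "inj_on p X"
    using less total by (intro inj_onI) (metis less_irrefl)
  moreover have "p ` X \<subseteq> {..<card X}"
  proof
    fix k assume "k \<in> p ` X"
    then obtain x where x: "x \<in> X" "k = p x" by blast
    then have "{y \<in> X. L y x} \<subset> X" using irrefl by blast
    then show "k \<in> {..<card X}" unfolding x(2) p_def using assms(1) by (simp add: psubset_card_mono)
  qed
  ultimately have "p ` X = {..<card X}"
    by (intro card_subset_eq) (auto simp: card_image)
  then show thesis using that \<open>inj_on p X\<close> iff by (simp add: bij_betw_def)
qed

text \<open>Sorting by the minimum of the block first, and by the element second, makes every block
  a run of consecutive positions. A crossing of two blocks would force equal minima, against
  disjointness.\<close>

lemma partition_ncross_ex:
  assumes "partition_on {1..n} \<pi>"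
  obtains p where "bij_betw p {1..n} {..<n}" "ncross p \<pi>"
proof -
  define m where "m = block_min \<pi>"
  have m: "m i = Min S" if "S \<in> \<pi>" "i \<in> S" for i S
    using block_min_eq[OF assms that] by (simp add: m_def)
  define L where "L x y \<longleftrightarrow> m x < m y \<or> m x = m y \<and> x < y" for x y
  obtain p where p: "bij_betw p {1..n} {..<card {1..n}}"
    "\<And>x y. x \<in> {1..n} \<Longrightarrow> y \<in> {1..n} \<Longrightarrow> p x < p y \<longleftrightarrow> L x y"
    by (rule rank_bij[of "{1..n}" L]) (auto simp: L_def)
  have S: "S \<subseteq> {1..n}" "finite S" "S \<noteq> {}" if "S \<in> \<pi>" for S
    using that assms finite_subset[of S "{1..n}"] by (auto simp: partition_on_def)
  have "\<not> cross p A B" if AB: "A \<in> \<pi>" "B \<in> \<pi>" "A \<noteq> B" for A B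
  proof
    have L: "m x \<le> m y" if "x \<in> A \<union> B" "y \<in> A \<union> B" "p x < p y" for x y
    proof -
      have "x \<in> {1..n}" "y \<in> {1..n}" using that(1,2) S(1)[OF AB(1)] S(1)[OF AB(2)] by blast+
      then have "L x y" using p(2) that(3) by blast
      then show ?thesis by (auto simp: L_def)
    qed
    assume "cross p A B"
    then have "Min A \<le> Min B" "Min B \<le> Min A"
      unfolding cross_def using L m[OF AB(1)] m[OF AB(2)] by (metis UnI1 UnI2)+
    then have "Min A \<in> A \<inter> B" using S[OF AB(1)] S[OF AB(2)] Min_in by (metis IntI order_antisym)
    then show False using AB assms by (auto simp: partition_on_def disjoint_def)
  qed
  then have "ncross p \<pi>" by (auto simp: ncross_def)
  then show thesis using that p(1) by simp
qed

text \<open>Passes from the span to explicit coefficients. They are indexed by \<open>I\<close>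
  instead of the set of vectors, so \<open>g\<close> may take equal values.\<close>

lemma span_image_finite_sum:
  fixes g :: "'b \<Rightarrow> 'a \<Rightarrow> real"
  assumes "finite I" "f \<in> fun_span (g ` I)"
  shows "\<exists>c. \<forall>x. f x = (\<Sum>i\<in>I. c i * g i x)"
proof -
  let ?S = "{f. \<exists>c. \<forall>x. f x = (\<Sum>i\<in>I. c i * g i x)}"
  have "fun_span (g ` I) \<subseteq> ?S" unfolding fun_span_def
  proof (rule fun_scale.span_minimal)
    show "g ` I \<subseteq> ?S"
    proof
      fix f assume "f \<in> g ` I"
      then obtain i where i: "i \<in> I" "f = g i" by blast
      then have "f x = (\<Sum>j\<in>I. (if j = i then 1 else 0) * g j x)" for x
        using assms(1) by (simp add: if_distrib[of "\<lambda>c. c * _"] cong: if_cong)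
      then show "f \<in> ?S" by (intro CollectI exI[of _ "\<lambda>j. if j = i then 1 else 0"]) blast
    qed
    show "fun_scale.subspace ?S"
    proof (rule fun_scale.subspaceI)
      show "0 \<in> ?S" by (intro CollectI exI[of _ "\<lambda>_. 0"]) simp
    next
      fix f h assume "f \<in> ?S" "h \<in> ?S"
      then obtain c d where "\<And>x. f x = (\<Sum>i\<in>I. c i * g i x)" "\<And>x. h x = (\<Sum>i\<in>I. d i * g i x)"
        by blast
      then show "f + h \<in> ?S"
        by (intro CollectI exI[of _ "\<lambda>i. c i + d i"]) (simp add: sum.distrib distrib_right)
    next
      fix a f assume "f \<in> ?S"
      then obtain c where "\<And>x. f x = (\<Sum>i\<in>I. c i * g i x)" by blast
      then show "fun_scale a f \<in> ?S"
        by (intro CollectI exI[of _ "\<lambda>i. a * c i"]) (simp add: fun_scale_def sum_distrib_left mult.assoc)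
    qed
  qed
  then show ?thesis using assms(2) by blast
qed

text \<open>A chain of adjacent exchanges leads from \<open>p\<close> to an ordering for which
  \<open>\<pi>\<close> is non-crossing, and no exchange leaves the span belonging to
  \<open>p\<close>.\<close>

lemma row_in_span_ncross:
  assumes p: "bij_betw p {1..n} {..<n}" and \<pi>: "partition_on {1..n} \<pi>"
  shows "forest_matrix_row n \<pi> \<in> fun_span (forest_matrix_row n ` ncross_partitions n p)"
proof -
  let ?span = "fun_span (forest_matrix_row n ` ncross_partitions n p)"
  have all: "forest_matrix_row n ` ncross_partitions n (q \<circ> p) \<subseteq> ?span" if "q permutes {..<n}" for q
    using that
  proof (induction rule: permutes_adjacent_induct)
    case id
    show ?case unfolding fun_span_def by (simp add: fun_scale.span_superset)
  next
    case (swap q k)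
    \<comment> \<open>\<open>q \<circ> p\<close> is the current ordering; the elements at its
      positions \<open>k\<close> and \<open>Suc k\<close> are exchanged.\<close>
    have qp: "bij_betw (q \<circ> p) {1..n} {..<n}"
      using p permutes_imp_bij[OF swap.hyps(1)] by (rule bij_betw_trans)
    then have "(q \<circ> p) ` {1..n} = {..<n}" by (rule bij_betw_imp_surj_on)
    then have k: "k \<in> (q \<circ> p) ` {1..n}" "Suc k \<in> (q \<circ> p) ` {1..n}" using swap.hyps(2) by auto
    obtain i where i: "i \<in> {1..n}" "(q \<circ> p) i = k" using k(1) by (metis imageE)
    obtain j where j: "j \<in> {1..n}" "(q \<circ> p) j = Suc k" using k(2) by (metis imageE)
    have "forest_matrix_row n \<pi> \<in> ?span" if "\<pi> \<in> ncross_partitions n (transpose k (Suc k) \<circ> q \<circ> p)" for \<pi>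
    proof -
      have "forest_matrix_row n \<pi> \<in> fun_span (forest_matrix_row n ` ncross_partitions n (q \<circ> p))"
      proof (rule row_in_span_adjacent_swap[OF bij_betw_imp_inj_on[OF qp] i(1) j(1)])
        show "(q \<circ> p) j = Suc ((q \<circ> p) i)" by (simp only: i(2) j(2))
        show "partition_on {1..n} \<pi>" using that by (simp add: ncross_partitions_def partitions_def)
        show "ncross (transpose ((q \<circ> p) i) ((q \<circ> p) j) \<circ> (q \<circ> p)) \<pi>"
          using that by (simp only: i(2) j(2) o_assoc ncross_partitions_def mem_Collect_eq)
      qed
      moreover have "fun_span (forest_matrix_row n ` ncross_partitions n (q \<circ> p)) \<subseteq> ?span"
        using swap.IH unfolding fun_span_def
        by (intro fun_scale.span_minimal fun_scale.subspace_span)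
      ultimately show ?thesis by blast
    qed
    then show ?case by blast
  qed
  obtain p' where p': "bij_betw p' {1..n} {..<n}" "ncross p' \<pi>"
    using partition_ncross_ex[OF \<pi>] .
  \<comment> \<open>The change of positions from \<open>p\<close> to \<open>p'\<close>, extended by
    the identity as \<open>permutes\<close> demands.\<close>
  define q where "q k = (if k < n then p' (inv_into {1..n} p k) else k)" for k
  have "bij_betw (p' \<circ> inv_into {1..n} p) {..<n} {..<n}"
    using bij_betw_inv_into[OF p] p'(1) by (rule bij_betw_trans)
  then have "bij_betw q {..<n} {..<n}"
    by (rule bij_betw_cong[THEN iffD1, rotated]) (simp add: q_def)
  then have "q permutes {..<n}" by (rule bij_imp_permutes) (simp add: q_def)
  moreover have "ncross (q \<circ> p) \<pi>"
  proof -
    have qp: "q (p x) = p' x" if "x \<in> {1..n}" for x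
      using that bij_betw_inv_into_left[OF p that] bij_betwE[OF p] by (simp add: q_def)
    have "\<not> cross (q \<circ> p) A B" if "A \<in> \<pi>" "B \<in> \<pi>" "A \<noteq> B" for A B
    proof
      have sub: "A \<subseteq> {1..n}" "B \<subseteq> {1..n}" using that(1,2) partition_onD1[OF \<pi>] by blast+
      assume "cross (q \<circ> p) A B"
      then have "cross p' A B"
      proof (rule cross_transfer[where g = id])
        fix x y assume "x \<in> A" "y \<in> B"
        then have "(q \<circ> p) x = p' x" "(q \<circ> p) y = p' y" using qp sub by auto
        then show "(q \<circ> p) x < (q \<circ> p) y \<Longrightarrow> p' (id x) < p' (id y)"
            "(q \<circ> p) y < (q \<circ> p) x \<Longrightarrow> p' (id y) < p' (id x)"
          by simp_all
      qed auto
      then show False using p'(2) that by (auto simp: ncross_def)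
    qed
    then show ?thesis by (auto simp: ncross_def)
  qed
  ultimately show ?thesis using all[of q] \<pi> by (auto simp: ncross_partitions_def partitions_def)
qed

theorem theorem25:
  fixes n :: nat and r :: "nat rel"
  assumes "linear_order_on {1..n} r"
  shows "(\<forall>\<pi>\<in>partitions n. \<exists>c :: nat set set \<Rightarrow> real. \<forall>\<rho>\<in>partitions n.
            forest_matrix n \<pi> \<rho> =
              (\<Sum>\<sigma>\<in>noncrossing_partitions n r. c \<sigma> * forest_matrix n \<sigma> \<rho>)) \<and>
         fun_span (forest_matrix_row n ` noncrossing_partitions n r) =
           fun_span (forest_matrix_row n ` partitions n)"
proof -
  let ?N = "noncrossing_partitions n r"
  let ?row = "forest_matrix_row n"
  have r: "trans r" "antisym r" "total_on {1..n} r"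
    using assms by (auto simp: linear_order_on_def partial_order_on_def preorder_on_def)
  \<comment> \<open>Ranking by \<open>r - Id\<close> replaces the relation by positions. They agree
    with \<open>r\<close> on \<open>{1..n}\<close>, which contains all blocks.\<close>
  obtain p where p: "bij_betw p {1..n} {..<card {1..n}}"
    "\<And>x y. x \<in> {1..n} \<Longrightarrow> y \<in> {1..n} \<Longrightarrow> p x < p y \<longleftrightarrow> (x, y) \<in> r - Id"
  proof (rule rank_bij[of "{1..n}" "\<lambda>x y. (x, y) \<in> r - Id"])
    show "(x, z) \<in> r - Id" if "(x, y) \<in> r - Id" "(y, z) \<in> r - Id" for x y z
      using that r(1,2) by (auto dest: transD antisymD)
    show "(x, y) \<in> r - Id \<or> (y, x) \<in> r - Id" if "x \<in> {1..n}" "y \<in> {1..n}" "x \<noteq> y" for x y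
      using that r(3) by (auto simp: total_on_def)
  qed auto
  have "noncrossing r \<pi> \<longleftrightarrow> ncross p \<pi>" if "partition_on {1..n} \<pi>" for \<pi>
  proof -
    have "crossing r A B \<longleftrightarrow> cross p A B" if "A \<in> \<pi>" "B \<in> \<pi>" for A B
    proof -
      have "A \<subseteq> {1..n}" "B \<subseteq> {1..n}" using that partition_onD1[OF \<open>partition_on {1..n} \<pi>\<close>] by blast+
      then have "p x < p y \<longleftrightarrow> (x, y) \<in> r - Id" if "x \<in> A \<union> B" "y \<in> A \<union> B" for x y
        using that p(2) by blast
      then show ?thesis unfolding crossing_def cross_def by (intro bex_cong refl) blast
    qed
    then show ?thesis by (simp add: noncrossing_def ncross_def)
  qed
  then have N: "?N = ncross_partitions n p"
    by (auto simp: noncrossing_partitions_def ncross_partitions_def partitions_def)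
  have span: "?row \<pi> \<in> fun_span (?row ` ?N)" if "\<pi> \<in> partitions n" for \<pi>
    using row_in_span_ncross[of p n \<pi>] p(1) that N by (simp add: partitions_def)
  have fin: "finite ?N"
    using finitely_many_partition_on[of "{1..n}"]
    by (auto simp: noncrossing_partitions_def partitions_def)
  have "\<exists>c. \<forall>\<rho>\<in>partitions n. forest_matrix n \<pi> \<rho> = (\<Sum>\<sigma>\<in>?N. c \<sigma> * forest_matrix n \<sigma> \<rho>)"
    if "\<pi> \<in> partitions n" for \<pi>
  proof -
    from span_image_finite_sum[OF fin span[OF that]]
    obtain c where c: "\<And>\<rho>. ?row \<pi> \<rho> = (\<Sum>\<sigma>\<in>?N. c \<sigma> * ?row \<sigma> \<rho>)" by blast
    have "forest_matrix n \<pi> \<rho> = (\<Sum>\<sigma>\<in>?N. c \<sigma> * forest_matrix n \<sigma> \<rho>)" if "\<rho> \<in> partitions n" for \<rho>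
      using c[of \<rho>] that by (simp add: forest_matrix_row_def)
    then show ?thesis by blast
  qed
  moreover have "fun_span (?row ` ?N) = fun_span (?row ` partitions n)"
  proof (rule subset_antisym)
    show "fun_span (?row ` ?N) \<subseteq> fun_span (?row ` partitions n)"
      unfolding fun_span_def
      by (intro fun_scale.span_mono) (auto simp: noncrossing_partitions_def)
    show "fun_span (?row ` partitions n) \<subseteq> fun_span (?row ` ?N)"
      using span unfolding fun_span_def
      by (intro fun_scale.span_minimal fun_scale.subspace_span) auto
  qed
  ultimately show ?thesis by blast
qed

end
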